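(* Let $\mathcal{H}$ be a Hilbert space with orthonormal basis $\{e_n\}_{n\ge0}$, and let $\Lambda:\mathcal{H}\to\mathcal{B}(\mathcal{H})$ satisfy the canonical anticommutation relations: for all $u,v\in\mathcal{H}$, $\Lambda(u)\Lambda(v)+\Lambda(v)\Lambda(u)=0$ and $\Lambda(u)\Lambda(v)^*+\Lambda(v)^*\Lambda(u)=(u,v)I$. Put $C_n=\Lambda(e_n)$. For $\alpha=(\alpha_0,\alpha_1,\ldots)\in\ell^2$ let $\Gamma_\alpha=[\alpha_{i+j}C_{i+j}]_{i,j\ge0}$, regarded as a bounded operator on $\ell^2(\mathcal{H})$, let $S\in\mathcal{B}(\ell^2(\mathcal{H}))$ be the unilateral forward shift $S(x_0,x_1,\ldots)=(0,x_0,x_1,\ldots)$, and let $$R(\Gamma_\alpha)=\begin{bmatrix}S^* & \Gamma_\alpha\\ 0 & S\end{bmatrix},\qquad R(0)=S^*\oplus S\qquad\text{in }\mathcal{B}(\ell^2(\mathcal{H})\oplus\ell^2(\mathcal{H})).$$ Then $R(\Gamma_\alpha)$ is similar to a contraction if and only if there is a constant $s$ such that for every $N\in\mathbb{N}$ and all $x_0,\ldots,x_N\in\{0\}\oplus(\mathcal{H}\oplus\{0\}\oplus\{0\}\oplus\cdots)$, $$\Big\|\sum_{n=0}^{N}\big(R(\Gamma_\alpha)^n-R(0)^n\big)x_n\Big\|\le s\Big(\sum_{n=0}^N\|x_n\|^2\Big)^{1/2}$$ (i.e. $R(\Gamma_\alpha)$ is quadratically near $S^*\oplus S$ modulo $\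mathcal{H}$).
   Context: An operator is similar to a contraction if it is conjugate by an invertible operator to an operator of norm at most 1. *)

theory Defs
  imports "HOL-Analysis.Analysis"
begin

class complex_vector = real_vector +
  fixes scaleC :: "complex \<Rightarrow> 'a \<Rightarrow> 'a" (infixr "*\<^sub>C" 75)
  assumes scaleC_add_right: "a *\<^sub>C (x + y) = a *\<^sub>C x + a *\<^sub>C y"
    and scaleC_add_left: "(a + b) *\<^sub>C x = a *\<^sub>C x + b *\<^sub>C x"
    and scaleC_scaleC: "a *\<^sub>C (b *\<^sub>C x) = (a * b) *\<^sub>C x"
    and scaleC_one: "1 *\<^sub>C x = x"
    and scaleR_scaleC: "scaleR r x = complex_of_real r *\<^sub>C x"

class complex_inner = complex_vector + real_normed_vector +
  fixes cinner :: "'a \<Rightarrow> 'a \<Rightarrow> complex"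
  assumes cinner_commute: "cinner x y = cnj (cinner y x)"
    and cinner_add_left: "cinner (x + y) z = cinner x z + cinner y z"
    and cinner_scaleC_left: "cinner (a *\<^sub>C x) y = a * cinner x y"
    and cinner_real_nonneg: "Im (cinner x x) = 0 \<and> 0 \<le> Re (cinner x x)"
    and cinner_eq_zero_iff: "cinner x x = 0 \<longleftrightarrow> x = 0"
    and norm_eq_sqrt_cinner: "norm x = sqrt (Re (cinner x x))"

(* A Hilbert space is a complete complex inner product space: we use the
sort complex_inner + complete_space. *)

definition orthonormal_basis :: "(nat \<Rightarrow> 'a::complex_inner) \<Rightarrow> bool" where
  "orthonormal_basis e \<longleftrightarrow>
     (\<forall>m n. cinner (e m) (e n) = (if m = n then 1 else 0)) \<and>
     (\<forall>x. (\<forall>n. cinner x (e n) = 0) \<longrightarrow> x = 0)"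

definition bounded_clinear_op :: "('a::complex_inner \<Rightarrow> 'a) \<Rightarrow> bool" where
  "bounded_clinear_op A \<longleftrightarrow>
     (\<forall>x y. A (x + y) = A x + A y) \<and> (\<forall>c x. A (c *\<^sub>C x) = c *\<^sub>C A x) \<and>
     (\<exists>K. \<forall>x. norm (A x) \<le> K * norm x)"

definition cadjoint :: "('a::complex_inner \<Rightarrow> 'a) \<Rightarrow> ('a \<Rightarrow> 'a)" where
  "cadjoint A = (SOME B. \<forall>x y. cinner (A x) y = cinner x (B y))"

definition CAR :: "('a::complex_inner \<Rightarrow> 'a \<Rightarrow> 'a) \<Rightarrow> bool" where
  "CAR \<Lambda> \<longleftrightarrow> (\<forall>u. bounded_clinear_op (\<Lambda> u)) \<and>
     (\<forall>u v x. \<Lambda> u (\<Lambda> v x) + \<Lambda> v (\<Lambda> u x) = 0) \<and>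
     (\<forall>u v x. \<Lambda> u (cadjoint (\<Lambda> v) x) + cadjoint (\<Lambda> v) (\<Lambda> u x) = cinner u v *\<^sub>C x)"

definition l2 :: "(nat \<Rightarrow> 'a::complex_inner) set" where
  "l2 = {x. summable (\<lambda>n. (norm (x n))\<^sup>2)}"

definition l2norm :: "(nat \<Rightarrow> 'a::complex_inner) \<Rightarrow> real" where
  "l2norm x = sqrt (\<Sum>n. (norm (x n))\<^sup>2)"

type_synonym 'a l2sum = "(nat \<Rightarrow> 'a) \<times> (nat \<Rightarrow> 'a)"

definition K2 :: "'a::complex_inner l2sum set" where
  "K2 = l2 \<times> l2"

definition Knorm :: "'a::complex_inner l2sum \<Rightarrow> real" where
  "Knorm z = sqrt ((l2norm (fst z))\<^sup>2 + (l2norm (snd z))\<^sup>2)"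

definition Kadd :: "'a::complex_inner l2sum \<Rightarrow> 'a l2sum \<Rightarrow> 'a l2sum" where
  "Kadd z w = ((\<lambda>k. fst z k + fst w k), (\<lambda>k. snd z k + snd w k))"

definition Kdiff :: "'a::complex_inner l2sum \<Rightarrow> 'a l2sum \<Rightarrow> 'a l2sum" where
  "Kdiff z w = ((\<lambda>k. fst z k - fst w k), (\<lambda>k. snd z k - snd w k))"

definition Kscale :: "complex \<Rightarrow> 'a::complex_inner l2sum \<Rightarrow> 'a l2sum" where
  "Kscale c z = ((\<lambda>k. c *\<^sub>C fst z k), (\<lambda>k. c *\<^sub>C snd z k))"

definition Ksum :: "(nat \<Rightarrow> 'a::complex_inner l2sum) \<Rightarrow> nat set \<Rightarrow> 'a l2sum" where
  "Ksum f A = ((\<lambda>k. \<Sum>n\<in>A. fst (f n) k), (\<lambda>k. \<Sum>n\<in>A. snd (f n) k))"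

(* Bounded linear operators on \<ell>^2(H) \<oplus> \<ell>^2(H) (only their values on the
space K2 matter). *)
definition bounded_K_op :: "('a::complex_inner l2sum \<Rightarrow> 'a l2sum) \<Rightarrow> bool" where
  "bounded_K_op T \<longleftrightarrow> T ` K2 \<subseteq> K2 \<and>
     (\<forall>z\<in>K2. \<forall>w\<in>K2. T (Kadd z w) = Kadd (T z) (T w)) \<and>
     (\<forall>c. \<forall>z\<in>K2. T (Kscale c z) = Kscale c (T z)) \<and>
     (\<exists>M. \<forall>z\<in>K2. Knorm (T z) \<le> M * Knorm z)"

definition invertible_K_op :: "('a::complex_inner l2sum \<Rightarrow> 'a l2sum) \<Rightarrow> bool" where
  "invertible_K_op T \<longleftrightarrow> bounded_K_op T \<and> bij_betw T K2 K2 \<and>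
     bounded_K_op (inv_into K2 T)"

definition similar_to_contraction :: "('a::complex_inner l2sum \<Rightarrow> 'a l2sum) \<Rightarrow> bool" where
  "similar_to_contraction R \<longleftrightarrow>
     (\<exists>T. invertible_K_op T \<and> (\<forall>z\<in>K2. Knorm (inv_into K2 T (R (T z))) \<le> Knorm z))"

definition fshift :: "(nat \<Rightarrow> 'a::complex_inner) \<Rightarrow> (nat \<Rightarrow> 'a)" where
  "fshift x = (\<lambda>n. if n = 0 then 0 else x (n - 1))"

definition bshift :: "(nat \<Rightarrow> 'a::complex_inner) \<Rightarrow> (nat \<Rightarrow> 'a)" where
  "bshift x = (\<lambda>n. x (Suc n))"

definition Hankel_op :: "(nat \<Rightarrow> complex) \<Rightarrow> (nat \<Rightarrow> 'a::complex_inner \<Rightarrow> 'a)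
    \<Rightarrow> (nat \<Rightarrow> 'a) \<Rightarrow> (nat \<Rightarrow> 'a)" where
  "Hankel_op \<alpha> C x = (\<lambda>i. \<Sum>j. \<alpha> (i + j) *\<^sub>C C (i + j) (x j))"

definition Rop :: "((nat \<Rightarrow> 'a::complex_inner) \<Rightarrow> (nat \<Rightarrow> 'a)) \<Rightarrow> 'a l2sum \<Rightarrow> 'a l2sum" where
  "Rop \<Gamma> z = ((\<lambda>k. bshift (fst z) k + \<Gamma> (snd z) k), fshift (snd z))"

definition R0 :: "'a::complex_inner l2sum \<Rightarrow> 'a l2sum" where
  "R0 z = (bshift (fst z), fshift (snd z))"

definition Hsub :: "'a::complex_inner l2sum set" where
  "Hsub = {((\<lambda>k. 0), (\<lambda>k. if k = 0 then h else 0)) | h. True}"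

definition quad_near_mod_H :: "('a::complex_inner l2sum \<Rightarrow> 'a l2sum) \<Rightarrow> ('a l2sum \<Rightarrow> 'a l2sum) \<Rightarrow> bool" where
  "quad_near_mod_H R R' \<longleftrightarrow> (\<exists>s. \<forall>N. \<forall>x :: nat \<Rightarrow> 'a l2sum. (\<forall>n\<le>N. x n \<in> Hsub) \<longrightarrow>
      Knorm (Ksum (\<lambda>n. Kdiff ((R ^^ n) (x n)) ((R' ^^ n) (x n))) {..N})
        \<le> s * sqrt (\<Sum>n\<le>N. (Knorm (x n))\<^sup>2))"

end

theory Submission
  imports Defs "HOL-Library.Discrete_Functions"
begin

text \<open>
  Since \<open>\<Gamma> S = S\<^sup>* \<Gamma>\<close>, the corner of \<open>R(\<Gamma>)\<^sup>n\<close> is \<open>n S\<^sup>*\<^sup>n\<^sup>-\<^sup>1 \<Gamma>\<close>, so quadratic nearness says that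
  the matrix \<open>W\<close> with entries \<open>(j + 1) \<alpha>\<^sub>i\<^sub>+\<^sub>j C\<^sub>i\<^sub>+\<^sub>j\<close> is bounded. Then \<open>X = W S\<^sup>*\<close> solves
  \<open>X S - S\<^sup>* X = \<Gamma>\<close>, and the shear by \<open>X\<close> conjugates \<open>R(\<Gamma>)\<close> to the contraction \<open>R(0)\<close>.

  For the converse, everything rests on \<open>T T\<^sup>* + T\<^sup>* T = \<parallel>c\<parallel>\<^sup>2 I\<close> for \<open>T = \<Sum> c\<^sub>k C\<^sub>k\<close>. Fourier transformation
  along the orbit of a contraction \<open>P\<close> that commutes with all \<open>C\<^sub>k\<close> and \<open>C\<^sub>k\<^sup>*\<close> gives the von Neumann inequality
  \<open>\<parallel>\<Sum> c\<^sub>k C\<^sub>k P\<^sup>k\<parallel> \<le> \<parallel>c\<parallel>\<close>. In a matrix model of the anticommutation relations with coefficients in the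
  space on which the conjugated \<open>R(\<Gamma>)\<close> acts, testing it on a maximally entangled Fock vector yields
  \<open>\<Sum> (k + 1)\<^sup>2 |\<alpha>\<^sub>k|\<^sup>2 < \<infinity>\<close>. The same Fourier argument bounds the Hankel matrix of a square-summable sequence by
  its norm, and a dyadic decomposition of the columns then bounds \<open>W\<close>.
\<close>

section \<open>Complex inner product spaces\<close>

interpretation scaleC_left: additive "\<lambda>a. a *\<^sub>C x" for x :: "'a::complex_vector"
  by unfold_locales (rule scaleC_add_left)

interpretation scaleC_right: additive "\<lambda>x::'a::complex_vector. a *\<^sub>C x"
  by unfold_locales (rule scaleC_add_right)

interpretation cinner_left: additive "\<lambda>x::'a::complex_inner. cinner x y"
  by unfold_locales (rule cinner_add_left)

lemma cinner_add_right: "cinner x (y + z) = cinner x y + cinner (x::'a::complex_inner) z"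
  by (metis cinner_add_left cinner_commute complex_cnj_add)

interpretation cinner_right: additive "\<lambda>y::'a::complex_inner. cinner x y"
  by unfold_locales (rule cinner_add_right)

declare scaleC_left.zero [simp] scaleC_right.zero [simp] cinner_left.zero [simp] cinner_right.zero [simp]
  scaleC_one [simp]

lemma cinner_scaleC_right: "cinner x (a *\<^sub>C y) = cnj a * cinner (x::'a::complex_inner) y"
  by (metis cinner_scaleC_left cinner_commute complex_cnj_mult)

lemma cinner_self: "cinner x x = complex_of_real ((norm (x::'a::complex_inner))\<^sup>2)"
  using cinner_real_nonneg[of x] by (simp add: complex_eq_iff norm_eq_sqrt_cinner)

lemma norm_square_eq_Re_cinner: "(norm x)\<^sup>2 = Re (cinner x (x::'a::complex_inner))"
  by (simp add: cinner_self)

lemma cinner_eqI: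
  fixes x y :: "'a::complex_inner"
  assumes "\<And>z. cinner x z = cinner y z"
  shows "x = y"
proof -
  have "cinner (x - y) (x - y) = 0" by (simp add: cinner_left.diff assms)
  then show ?thesis by (simp add: cinner_eq_zero_iff)
qed

lemma cinner_combination:
  fixes u v :: "_ \<Rightarrow> 'a::complex_inner"
  shows "cinner (\<Sum>i\<in>I. a i *\<^sub>C u i) (\<Sum>j\<in>J. b j *\<^sub>C v j) =
    (\<Sum>i\<in>I. \<Sum>j\<in>J. a i * cnj (b j) * cinner (u i) (v j))"
  unfolding cinner_left.sum cinner_scaleC_left
  by (simp add: cinner_right.sum cinner_scaleC_right sum_distrib_left mult.assoc)

lemma norm_scaleC: "norm (c *\<^sub>C x) = cmod c * norm (x::'a::complex_inner)"
proof -
  have "cinner (c *\<^sub>C x) (c *\<^sub>C x) = (c * cnj c) * cinner x x"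
    by (simp add: cinner_scaleC_left cinner_scaleC_right)
  also have "\<dots> = complex_of_real ((cmod c * norm x)\<^sup>2)"
    by (simp add: cinner_self complex_norm_square[symmetric] power_mult_distrib)
  finally have "(norm (c *\<^sub>C x))\<^sup>2 = (cmod c * norm x)\<^sup>2"
    by (simp only: norm_square_eq_Re_cinner Re_complex_of_real)
  then show ?thesis by simp
qed

lemma norm_add_square:
  "(norm (x + y))\<^sup>2 = (norm x)\<^sup>2 + 2 * Re (cinner x y) + (norm (y::'a::complex_inner))\<^sup>2"
  using cinner_commute[of x y]
  by (simp add: norm_square_eq_Re_cinner cinner_add_left cinner_add_right)

lemma parallelogram_law:
  "(norm (x + y))\<^sup>2 + (norm (x - y))\<^sup>2 = 2 * (norm x)\<^sup>2 + 2 * (norm (y::'a::complex_inner))\<^sup>2"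
  using norm_add_square[of x y] norm_add_square[of x "- y"] by (simp add: cinner_right.minus)

lemma Cauchy_Schwarz_cinner: "cmod (cinner x y) \<le> norm x * norm (y::'a::complex_inner)"
proof (cases "y = 0")
  case False
  define t where "t = cinner x y / complex_of_real ((norm y)\<^sup>2)"
  define z where "z = x - t *\<^sub>C y"
  have "cinner z (t *\<^sub>C y) = 0"
    using False by (simp add: z_def t_def cinner_left.diff cinner_scaleC_left cinner_scaleC_right cinner_self)
  then have "(norm x)\<^sup>2 = (norm z)\<^sup>2 + (cmod t * norm y)\<^sup>2"
    using norm_add_square[of z "t *\<^sub>C y"] by (simp add: z_def norm_scaleC)
  then have "cmod t * norm y \<le> norm x"
    by (intro power2_le_imp_le[of "cmod t * norm y"]) simp_all
  then show ?thesis
    using False by (simp add: t_def norm_divide norm_mult divide_simps power2_eq_square)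
qed simp

lemma bounded_linear_cinner_left: "bounded_linear (\<lambda>x::'a::complex_inner. cinner x y)"
  by (rule bounded_linear_intro[where K = "norm y"])
    (simp_all add: cinner_add_left scaleR_scaleC cinner_scaleC_left scaleR_conv_of_real Cauchy_Schwarz_cinner)

lemma bounded_linear_scaleC_right: "bounded_linear (\<lambda>x::'a::complex_inner. c *\<^sub>C x)"
  by (rule bounded_linear_intro[where K = "cmod c"])
    (simp_all add: scaleC_add_right scaleR_scaleC scaleC_scaleC norm_scaleC mult.commute)

locale bounded_clinear = bounded_linear f for f :: "'a::complex_inner \<Rightarrow> 'b::complex_inner" +
  assumes scaleC: "f (c *\<^sub>C x) = c *\<^sub>C f x"
begin

lemma scaleC_sum: "f (\<Sum>i\<in>I. c i *\<^sub>C x i) = (\<Sum>i\<in>I. c i *\<^sub>C f (x i))"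
  by (simp add: sum scaleC)

end

lemma bounded_clinear_intro:
  assumes "\<And>x y. f (x + y) = f x + f y" "\<And>c x. f (c *\<^sub>C x) = c *\<^sub>C f x" "\<And>x. norm (f x) \<le> K * norm x"
  shows "bounded_clinear f"
proof -
  have "bounded_linear f"
    using assms by (intro bounded_linear_intro[where K = K]) (simp_all add: scaleR_scaleC mult.commute)
  then show ?thesis
    by (rule bounded_clinear.intro) (simp add: bounded_clinear_axioms_def assms)
qed

lemma bounded_clinear_ident: "bounded_clinear (\<lambda>x. x)"
  by (rule bounded_clinear_intro[where K = 1]) simp_all

lemma bounded_clinear_scaleC: "bounded_clinear (\<lambda>x. c *\<^sub>C x)"
  by (rule bounded_clinear_intro[where K = "cmod c"])
    (simp_all add: scaleC_add_right scaleC_scaleC norm_scaleC mult.commute)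

lemma bounded_clinear_compose:
  assumes "bounded_clinear f" "bounded_clinear g"
  shows "bounded_clinear (\<lambda>x. f (g x))"
proof -
  interpret f: bounded_clinear f by fact
  interpret g: bounded_clinear g by fact
  have "bounded_linear (\<lambda>x. f (g x))"
    by (rule bounded_linear_compose) (rule f.bounded_linear_axioms g.bounded_linear_axioms)+
  then show ?thesis
    by (rule bounded_clinear.intro) (simp add: bounded_clinear_axioms_def f.scaleC g.scaleC)
qed

lemma bounded_clinear_funpow:
  fixes f :: "'a::complex_inner \<Rightarrow> 'a"
  shows "bounded_clinear f \<Longrightarrow> bounded_clinear (f ^^ n)"
proof (induction n)
  case 0
  show ?case unfolding funpow.simps id_def by (rule bounded_clinear_ident)
next
  case (Suc n)
  then have "bounded_clinear (f ^^ n)" by simp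
  with Suc.prems show ?case unfolding funpow.simps comp_def by (rule bounded_clinear_compose)
qed

section \<open>Adjoints in Hilbert space\<close>

lemma uniformly_convex_minimizer:
  fixes F :: "'a::{real_normed_vector, complete_space} \<Rightarrow> real"
  assumes cont: "continuous_on UNIV F" and bdd: "bdd_below (range F)"
    and convex: "\<And>x y. (norm (x - y))\<^sup>2 \<le> 2 * F x + 2 * F y - 4 * F ((1 / 2) *\<^sub>R (x + y))"
  obtains w where "\<And>x. F w \<le> F x"
proof -
  define I where "I = Inf (range F)"
  have I: "I \<le> F x" for x unfolding I_def by (rule cInf_lower[OF rangeI bdd])
  have "\<exists>x. F x < I + inverse (real (Suc n))" for n
  proof -
    have "I < I + inverse (real (Suc n))" by simp
    then show ?thesis unfolding I_def by (subst (asm) cInf_less_iff) (use bdd in auto)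
  qed
  then obtain x where x: "\<And>n. F (x n) < I + inverse (real (Suc n))" by metis
  have close: "(norm (x m - x n))\<^sup>2 \<le> 4 * inverse (real (Suc N))" if "N \<le> m" "N \<le> n" for m n N
  proof -
    have "inverse (real (Suc m)) \<le> inverse (real (Suc N))" "inverse (real (Suc n)) \<le> inverse (real (Suc N))"
      using that by (simp_all add: le_imp_inverse_le)
    then show ?thesis
      using convex[of "x m" "x n"] I[of "(1 / 2) *\<^sub>R (x m + x n)"] x[of m] x[of n] by linarith
  qed
  have "Cauchy x"
  proof (rule metric_CauchyI)
    fix \<epsilon> :: real assume \<epsilon>: "0 < \<epsilon>"
    obtain N where N: "inverse (real (Suc N)) < \<epsilon>\<^sup>2 / 4"
      using reals_Archimedean[of "\<epsilon>\<^sup>2 / 4"] \<epsilon> by auto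
    have "dist (x m) (x n) < \<epsilon>" if "N \<le> m" "N \<le> n" for m n
    proof (rule power2_less_imp_less)
      show "(dist (x m) (x n))\<^sup>2 < \<epsilon>\<^sup>2" using close[OF that] N unfolding dist_norm by linarith
    qed (use \<epsilon> in simp)
    then show "\<exists>N. \<forall>m\<ge>N. \<forall>n\<ge>N. dist (x m) (x n) < \<epsilon>" by blast
  qed
  then obtain w where w: "x \<longlonglongrightarrow> w" using Cauchy_convergent unfolding convergent_def by blast
  have "(\<lambda>n. F (x n)) \<longlonglongrightarrow> F w"
    using continuous_on_tendsto_compose[OF cont w] by simp
  then have "F w \<le> I"
    using x by (intro LIMSEQ_le[OF _ LIMSEQ_inverse_real_of_nat_add[of I]]) (auto intro: less_imp_le)
  then have "F w \<le> F y" for y using I[of y] by simp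
  then show ?thesis by (rule that)
qed

lemma linear_coefficient_eq_0:
  fixes a b :: real
  assumes "\<And>t. 0 \<le> a * t\<^sup>2 + b * t" "0 \<le> a"
  shows "b = 0"
proof (rule ccontr)
  assume "b \<noteq> 0"
  define t where "t = - b / (a + 1)"
  have "b = - (a + 1) * t" using assms(2) by (simp add: t_def field_simps)
  then have "a * t\<^sup>2 + b * t = - t\<^sup>2" by algebra
  moreover have "0 < t\<^sup>2" using \<open>b \<noteq> 0\<close> assms(2) by (simp add: t_def)
  ultimately show False using assms(1)[of t] by linarith
qed

text \<open>The representing vector minimizes \<open>\<parallel>x\<parallel>\<^sup>2 - 2 Re (\<phi> x)\<close>.\<close>

theorem Riesz_representation:
  fixes \<phi> :: "'a::{complex_inner, complete_space} \<Rightarrow> complex"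
  assumes \<phi>: "bounded_linear \<phi>" and \<phi>_scaleC: "\<And>c x. \<phi> (c *\<^sub>C x) = c * \<phi> x"
  obtains w where "\<And>x. \<phi> x = cinner x w"
proof -
  interpret bounded_linear \<phi> by (rule \<phi>)
  define F where "F x = (norm x)\<^sup>2 - 2 * Re (\<phi> x)" for x
  obtain K where K: "\<And>x. cmod (\<phi> x) \<le> norm x * K" using bounded by blast
  have "- K\<^sup>2 \<le> F x" for x
  proof -
    have "Re (\<phi> x) \<le> norm x * K" using complex_Re_le_cmod K by (rule order_trans)
    then show ?thesis
      using zero_le_power2[of "norm x - K"] unfolding F_def power2_diff by linarith
  qed
  then have bdd: "bdd_below (range F)" by (intro bdd_belowI2)
  have cont: "continuous_on UNIV F"
    unfolding F_def by (intro continuous_intros continuous_on)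
  have convex: "(norm (x - y))\<^sup>2 \<le> 2 * F x + 2 * F y - 4 * F ((1 / 2) *\<^sub>R (x + y))" for x y
    using parallelogram_law[of x y] unfolding F_def scaleR add
    by (simp add: power_divide add_divide_distrib)
  obtain w where w: "\<And>x. F w \<le> F x"
    using uniformly_convex_minimizer[OF cont bdd convex] by blast
  have Re_eq: "Re (\<phi> h) = Re (cinner h w)" for h
  proof -
    have "2 * (Re (cinner w h) - Re (\<phi> h)) = 0"
    proof (rule linear_coefficient_eq_0[of "(norm h)\<^sup>2"])
      fix t :: real
      have "F (w + t *\<^sub>R h) - F w = (norm h)\<^sup>2 * t\<^sup>2 + 2 * (Re (cinner w h) - Re (\<phi> h)) * t"
        using cinner_scaleC_right[of w "complex_of_real t" h]
        by (simp add: F_def norm_add_square add scaleR scaleR_scaleC[symmetric] power_mult_distrib algebra_simps)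
      then show "0 \<le> (norm h)\<^sup>2 * t\<^sup>2 + 2 * (Re (cinner w h) - Re (\<phi> h)) * t" using w[of "w + t *\<^sub>R h"] by linarith
    qed simp
    then show ?thesis using cinner_commute[of w h] by simp
  qed
  have "\<phi> x = cinner x w" for x
    using Re_eq[of x] Re_eq[of "\<i> *\<^sub>C x"] by (simp add: complex_eq_iff \<phi>_scaleC cinner_scaleC_left)
  then show ?thesis by (rule that)
qed

lemma bounded_clinear_op_iff: "bounded_clinear_op A \<longleftrightarrow> bounded_clinear A"
proof
  assume "bounded_clinear_op A"
  then obtain K where "\<And>x y. A (x + y) = A x + A y" "\<And>c x. A (c *\<^sub>C x) = c *\<^sub>C A x"
    "\<And>x. norm (A x) \<le> K * norm x"
    unfolding bounded_clinear_op_def by blast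
  then show "bounded_clinear A" by (rule bounded_clinear_intro)
next
  assume "bounded_clinear A"
  then interpret bounded_clinear A .
  obtain K where "\<And>x. norm (A x) \<le> norm x * K" using bounded by blast
  then show "bounded_clinear_op A"
    unfolding bounded_clinear_op_def by (simp add: add scaleC) (metis mult.commute)
qed

lemma cinner_cadjoint:
  fixes A :: "'a::{complex_inner, complete_space} \<Rightarrow> 'a"
  assumes "bounded_clinear A"
  shows "cinner (A x) y = cinner x (cadjoint A y)"
proof -
  interpret bounded_clinear A by fact
  have "\<exists>w. \<forall>x. cinner (A x) y = cinner x w" for y
  proof (rule Riesz_representation[of "\<lambda>x. cinner (A x) y"])
    show "bounded_linear (\<lambda>x. cinner (A x) y)"
      by (rule bounded_linear_compose[OF bounded_linear_cinner_left bounded_linear_axioms])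
    show "cinner (A (c *\<^sub>C x)) y = c * cinner (A x) y" for c x
      by (simp add: scaleC cinner_scaleC_left)
  qed blast
  then have "\<exists>B. \<forall>x y. cinner (A x) y = cinner x (B y)" by metis
  then show ?thesis unfolding cadjoint_def by (rule someI2_ex) blast
qed

section \<open>Square-summable families and direct sums\<close>

definition square_summable :: "('i \<Rightarrow> 'a::real_normed_vector) \<Rightarrow> bool" where
  "square_summable f \<longleftrightarrow> (\<lambda>i. (norm (f i))\<^sup>2) summable_on UNIV"

lemma square_summable_bounded:
  assumes "\<And>F. finite F \<Longrightarrow> (\<Sum>i\<in>F. (norm (f i))\<^sup>2) \<le> B"
  shows "square_summable f"
  unfolding square_summable_def
  by (rule nonneg_bdd_above_summable_on) (auto intro!: bdd_aboveI2 assms)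

lemma square_summable_finite_support:
  assumes "finite F" "\<And>i. i \<notin> F \<Longrightarrow> f i = 0"
  shows "square_summable f"
proof -
  have "(\<lambda>i. (norm (f i))\<^sup>2) summable_on F" using assms(1) by simp
  then show ?thesis
    unfolding square_summable_def by (subst summable_on_cong_neutral) (auto simp: assms(2))
qed

lemma square_summable_reindex:
  assumes "square_summable f" "inj_on h A" "\<And>i. i \<in> A \<Longrightarrow> norm (g i) = norm (f (h i))"
    "\<And>i. i \<notin> A \<Longrightarrow> g i = 0"
  shows "square_summable g"
proof -
  have "(\<lambda>i. (norm (f i))\<^sup>2) summable_on h ` A"
    using assms(1) unfolding square_summable_def by (rule summable_on_subset_banach) simp
  then have "(\<lambda>i. (norm (f (h i)))\<^sup>2) summable_on A"
    by (simp add: summable_on_reindex[OF assms(2)] comp_def)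
  then show ?thesis
    unfolding square_summable_def by (subst summable_on_cong_neutral) (auto simp: assms(3,4))
qed

lemma square_summable_scaleC:
  "square_summable f \<Longrightarrow> square_summable (\<lambda>i. c *\<^sub>C (f i :: 'a::complex_inner))"
  unfolding square_summable_def norm_scaleC power_mult_distrib by (rule summable_on_cmult_right)

lemma square_summable_parallelogram:
  fixes f g :: "'i \<Rightarrow> 'a::complex_inner"
  assumes "square_summable f" "square_summable g"
  shows "square_summable (\<lambda>i. f i + g i)" "square_summable (\<lambda>i. f i - g i)"
proof -
  have s: "(\<lambda>i. 2 * (norm (f i))\<^sup>2 + 2 * (norm (g i))\<^sup>2) summable_on UNIV"
    using assms unfolding square_summable_def by (intro summable_on_add summable_on_cmult_right)
  have le: "(norm (f i + g i))\<^sup>2 \<le> 2 * (norm (f i))\<^sup>2 + 2 * (norm (g i))\<^sup>2"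
    "(norm (f i - g i))\<^sup>2 \<le> 2 * (norm (f i))\<^sup>2 + 2 * (norm (g i))\<^sup>2" for i
    using parallelogram_law[of "f i" "g i"] zero_le_power2[of "norm (f i + g i)"]
      zero_le_power2[of "norm (f i - g i)"] by linarith+
  show "square_summable (\<lambda>i. f i + g i)" "square_summable (\<lambda>i. f i - g i)"
    unfolding square_summable_def by (rule summable_on_comparison_test[OF s]; simp add: le)+
qed

lemma square_summable_cinner:
  fixes f g :: "'i \<Rightarrow> 'a::complex_inner"
  assumes "square_summable f" "square_summable g"
  shows "(\<lambda>i. cinner (f i) (g i)) summable_on UNIV"
proof (rule abs_summable_summable[OF Infinite_Sum.abs_summable_on_comparison_test'])
  show "(\<lambda>i. (norm (f i))\<^sup>2 + (norm (g i))\<^sup>2) summable_on UNIV"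
    using assms unfolding square_summable_def by (rule summable_on_add)
  fix i
  have "cmod (cinner (f i) (g i)) \<le> norm (f i) * norm (g i)" by (rule Cauchy_Schwarz_cinner)
  also have "\<dots> \<le> (norm (f i))\<^sup>2 + (norm (g i))\<^sup>2"
    using sum_squares_bound[of "norm (f i)" "norm (g i)"]
      mult_nonneg_nonneg[OF norm_ge_zero norm_ge_zero, of "f i" "g i"] by linarith
  finally show "cmod (cinner (f i) (g i)) \<le> (norm (f i))\<^sup>2 + (norm (g i))\<^sup>2" .
qed

typedef (overloaded) ('i, 'a::complex_inner) ell2 = "{f :: 'i \<Rightarrow> 'a::complex_inner. square_summable f}"
  morphisms coord Abs_ell2
  by (auto intro: square_summable_finite_support[of "{}"])

setup_lifting type_definition_ell2

lemma square_summable_coord: "square_summable (coord x)"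
  using coord by blast

lemma coord_Abs_ell2: "square_summable f \<Longrightarrow> coord (Abs_ell2 f) = f"
  by (simp add: Abs_ell2_inverse)

lemma ell2_eqI: "(\<And>i. coord x i = coord y i) \<Longrightarrow> x = y"
  by (simp add: coord_inject[symmetric] fun_eq_iff)

instantiation ell2 :: (type, complex_inner) complex_vector
begin

lift_definition zero_ell2 :: "('a, 'b) ell2" is "\<lambda>_. 0"
  by (rule square_summable_finite_support[of "{}"]) simp_all

lift_definition plus_ell2 :: "('a, 'b) ell2 \<Rightarrow> ('a, 'b) ell2 \<Rightarrow> ('a, 'b) ell2" is "\<lambda>f g i. f i + g i"
  by (rule square_summable_parallelogram)

lift_definition minus_ell2 :: "('a, 'b) ell2 \<Rightarrow> ('a, 'b) ell2 \<Rightarrow> ('a, 'b) ell2" is "\<lambda>f g i. f i - g i"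
  by (rule square_summable_parallelogram)

lift_definition uminus_ell2 :: "('a, 'b) ell2 \<Rightarrow> ('a, 'b) ell2" is "\<lambda>f i. - f i"
  by (simp add: square_summable_def)

lift_definition scaleC_ell2 :: "complex \<Rightarrow> ('a, 'b) ell2 \<Rightarrow> ('a, 'b) ell2" is "\<lambda>c f i. c *\<^sub>C f i"
  by (rule square_summable_scaleC)

lift_definition scaleR_ell2 :: "real \<Rightarrow> ('a, 'b) ell2 \<Rightarrow> ('a, 'b) ell2" is "\<lambda>r f i. r *\<^sub>R f i"
  unfolding scaleR_scaleC by (rule square_summable_scaleC)

instance
  by standard
    (transfer, simp add: algebra_simps scaleC_add_left scaleC_add_right scaleC_scaleC scaleR_scaleC)+

end

declare zero_ell2.rep_eq [simp] plus_ell2.rep_eq [simp] minus_ell2.rep_eq [simp]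
  uminus_ell2.rep_eq [simp] scaleC_ell2.rep_eq [simp] scaleR_ell2.rep_eq [simp]

lemma coord_sum: "coord (\<Sum>j\<in>J. x j) i = (\<Sum>j\<in>J. coord (x j) i)"
  by (induction J rule: infinite_finite_induct) simp_all

instantiation ell2 :: (type, complex_inner) complex_inner
begin

definition norm_ell2 :: "('a, 'b) ell2 \<Rightarrow> real" where
  "norm_ell2 x = sqrt (\<Sum>\<^sub>\<infinity>i. (norm (coord x i))\<^sup>2)"

definition cinner_ell2 :: "('a, 'b) ell2 \<Rightarrow> ('a, 'b) ell2 \<Rightarrow> complex" where
  "cinner_ell2 x y = (\<Sum>\<^sub>\<infinity>i. cinner (coord x i) (coord y i))"

definition sgn_ell2 :: "('a, 'b) ell2 \<Rightarrow> ('a, 'b) ell2" where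
  "sgn_ell2 x = x /\<^sub>R norm x"

definition dist_ell2 :: "('a, 'b) ell2 \<Rightarrow> ('a, 'b) ell2 \<Rightarrow> real" where
  "dist_ell2 x y = norm (x - y)"

definition uniformity_ell2 :: "(('a, 'b) ell2 \<times> ('a, 'b) ell2) filter" where
  "uniformity_ell2 = (INF \<epsilon>\<in>{0<..}. principal {(x, y). dist x y < \<epsilon>})"

definition open_ell2 :: "('a, 'b) ell2 set \<Rightarrow> bool" where
  "open_ell2 U \<longleftrightarrow> (\<forall>x\<in>U. eventually (\<lambda>(x', y). x' = x \<longrightarrow> y \<in> U) uniformity)"

lemma norm_ell2_square: "(norm x)\<^sup>2 = (\<Sum>\<^sub>\<infinity>i. (norm (coord x i))\<^sup>2)" for x :: "('a, 'b) ell2"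
  by (simp add: norm_ell2_def infsum_nonneg)

lemma sum_coord_le_norm: "finite F \<Longrightarrow> (\<Sum>i\<in>F. (norm (coord x i))\<^sup>2) \<le> (norm x)\<^sup>2"
  for x :: "('a, 'b) ell2"
  unfolding norm_ell2_square using square_summable_coord[of x]
  by (intro finite_sum_le_infsum) (simp_all add: square_summable_def)

lemma norm_ell2_le:
  fixes x :: "('a, 'b) ell2"
  assumes "\<And>F. finite F \<Longrightarrow> (\<Sum>i\<in>F. (norm (coord x i))\<^sup>2) \<le> B"
  shows "(norm x)\<^sup>2 \<le> B"
  unfolding norm_ell2_square using square_summable_coord[of x]
  by (intro infsum_le_finite_sums assms) (simp_all add: square_summable_def)

lemma norm_ell2_triangle: "norm (x + y) \<le> norm x + norm y" for x y :: "('a, 'b) ell2"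
proof (rule power2_le_imp_le, rule norm_ell2_le)
  fix F :: "'a set" assume "finite F"
  let ?L = "\<lambda>z. L2_set (\<lambda>i. norm (coord z i)) F"
  have le: "?L z \<le> norm z" for z :: "('a, 'b) ell2"
  proof (rule power2_le_imp_le)
    show "(?L z)\<^sup>2 \<le> (norm z)\<^sup>2"
      using sum_coord_le_norm[OF \<open>finite F\<close>, of z] by (simp add: L2_set_def sum_nonneg)
  qed (simp add: norm_ell2_def infsum_nonneg)
  have "?L (x + y) \<le> L2_set (\<lambda>i. norm (coord x i) + norm (coord y i)) F"
    by (rule L2_set_mono) (simp_all add: norm_triangle_ineq)
  also have "\<dots> \<le> ?L x + ?L y" by (rule L2_set_triangle_ineq)
  also have "\<dots> \<le> norm x + norm y" by (intro add_mono le)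
  finally have "(?L (x + y))\<^sup>2 \<le> (norm x + norm y)\<^sup>2" by (intro power_mono) simp_all
  then show "(\<Sum>i\<in>F. (norm (coord (x + y) i))\<^sup>2) \<le> (norm x + norm y)\<^sup>2"
    by (simp add: L2_set_def sum_nonneg)
qed (simp add: norm_ell2_def infsum_nonneg)

instance
proof
  fix x y z :: "('a, 'b) ell2" and r :: real and c :: complex and U :: "('a, 'b) ell2 set"
  note cinner_summable = square_summable_cinner[OF square_summable_coord square_summable_coord]
  show "dist x y = norm (x - y)" by (rule dist_ell2_def)
  show "sgn x = x /\<^sub>R norm x" by (rule sgn_ell2_def)
  show "(uniformity :: (('a, 'b) ell2 \<times> ('a, 'b) ell2) filter) =
      (INF \<epsilon>\<in>{0<..}. principal {(x, y). dist x y < \<epsilon>})" by (rule uniformity_ell2_def)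
  show "open U \<longleftrightarrow> (\<forall>x\<in>U. eventually (\<lambda>(x', y). x' = x \<longrightarrow> y \<in> U) uniformity)" by (rule open_ell2_def)
  have zero_iff: "(\<Sum>\<^sub>\<infinity>i. (norm (coord x i))\<^sup>2) = 0 \<longleftrightarrow> x = 0"
  proof
    assume "(\<Sum>\<^sub>\<infinity>i. (norm (coord x i))\<^sup>2) = 0"
    then have "(norm (coord x i))\<^sup>2 = 0" for i
      using square_summable_coord[of x] unfolding square_summable_def
      by (intro nonneg_infsum_le_0D[of "\<lambda>i. (norm (coord x i))\<^sup>2" UNIV]) simp_all
    then show "x = 0" by (intro ell2_eqI) simp
  qed simp
  then show "norm x = 0 \<longleftrightarrow> x = 0" by (simp add: norm_ell2_def)
  show "norm (x + y) \<le> norm x + norm y" by (rule norm_ell2_triangle)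
  show "norm (r *\<^sub>R x) = \<bar>r\<bar> * norm x"
    by (simp add: norm_ell2_def power_mult_distrib infsum_cmult_right' real_sqrt_mult)
  show "cinner x y = cnj (cinner y x)"
    unfolding cinner_ell2_def infsum_cnj[symmetric] cinner_commute[symmetric] ..
  show "cinner (x + y) z = cinner x z + cinner y z"
    by (simp add: cinner_ell2_def cinner_add_left infsum_add cinner_summable)
  show "cinner (c *\<^sub>C x) y = c * cinner x y"
    by (simp add: cinner_ell2_def cinner_scaleC_left infsum_cmult_right')
  have self: "cinner x x = complex_of_real (\<Sum>\<^sub>\<infinity>i. (norm (coord x i))\<^sup>2)"
    unfolding cinner_ell2_def cinner_self using square_summable_coord[of x]
    by (intro infsumI has_sum_of_real has_sum_infsum) (simp add: square_summable_def)
  show "Im (cinner x x) = 0 \<and> 0 \<le> Re (cinner x x)" by (simp add: self infsum_nonneg)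
  show "cinner x x = 0 \<longleftrightarrow> x = 0" by (simp only: self of_real_eq_0_iff zero_iff)
  show "norm x = sqrt (Re (cinner x x))" by (simp add: self norm_ell2_def)
qed

end

lemma norm_coord_le: "norm (coord x i) \<le> norm x"
  using sum_coord_le_norm[of "{i}" x] by simp

lemma norm_square_ell2_finite_support:
  assumes "finite F" "\<And>i. i \<notin> F \<Longrightarrow> coord x i = 0"
  shows "(norm x)\<^sup>2 = (\<Sum>i\<in>F. (norm (coord x i))\<^sup>2)"
proof -
  have "(norm x)\<^sup>2 = (\<Sum>\<^sub>\<infinity>i\<in>F. (norm (coord x i))\<^sup>2)"
    unfolding norm_ell2_square by (rule infsum_cong_neutral) (simp_all add: assms(2))
  then show ?thesis using assms(1) by simp
qed

lemma sum_nat_norm_square_le: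
  fixes f :: "nat \<Rightarrow> 'a::real_normed_vector"
  assumes "\<And>L. (\<Sum>i<L. (norm (f i))\<^sup>2) \<le> B" "finite F"
  shows "(\<Sum>i\<in>F. (norm (f i))\<^sup>2) \<le> B"
proof -
  obtain L where "F \<subseteq> {..<L}" using finite_nat_iff_bounded[of F] assms(2) by blast
  then have "(\<Sum>i\<in>F. (norm (f i))\<^sup>2) \<le> (\<Sum>i<L. (norm (f i))\<^sup>2)" by (intro sum_mono2) simp_all
  then show ?thesis using assms(1)[of L] by simp
qed

lemma norm_ell2_reindex_le:
  fixes x :: "('j, 'a::complex_inner) ell2" and y :: "('i, 'a) ell2"
  assumes "inj_on h A" "\<And>i. i \<in> A \<Longrightarrow> coord y i = coord x (h i)" "\<And>i. i \<notin> A \<Longrightarrow> coord y i = 0"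
  shows "norm y \<le> norm x"
proof (rule power2_le_imp_le, rule norm_ell2_le)
  fix F :: "'i set" assume "finite F"
  have "(\<Sum>i\<in>F. (norm (coord y i))\<^sup>2) = (\<Sum>i\<in>F \<inter> A. (norm (coord x (h i)))\<^sup>2)"
    using \<open>finite F\<close> by (intro sum.mono_neutral_cong_right) (auto simp: assms(2,3))
  also have "\<dots> = (\<Sum>i\<in>h ` (F \<inter> A). (norm (coord x i))\<^sup>2)"
    using inj_on_subset[OF assms(1)] by (subst sum.reindex) auto
  also have "\<dots> \<le> (norm x)\<^sup>2" using \<open>finite F\<close> by (intro sum_coord_le_norm) simp
  finally show "(\<Sum>i\<in>F. (norm (coord y i))\<^sup>2) \<le> (norm x)\<^sup>2" .
qed simp

lemma norm_ell2_square_le_iff: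
  fixes x :: "(nat, 'a::complex_inner) ell2"
  shows "(norm x)\<^sup>2 \<le> B \<longleftrightarrow> (\<forall>L. (\<Sum>i<L. (norm (coord x i))\<^sup>2) \<le> B)"
proof
  assume "(norm x)\<^sup>2 \<le> B"
  moreover have "(\<Sum>i<L. (norm (coord x i))\<^sup>2) \<le> (norm x)\<^sup>2" for L
    by (rule sum_coord_le_norm) simp
  ultimately show "\<forall>L. (\<Sum>i<L. (norm (coord x i))\<^sup>2) \<le> B" by (meson order_trans)
next
  assume partial: "\<forall>L. (\<Sum>i<L. (norm (coord x i))\<^sup>2) \<le> B"
  have "(\<Sum>i\<in>F. (norm (coord x i))\<^sup>2) \<le> B" if "finite F" for F
    by (rule sum_nat_norm_square_le[OF _ that]) (simp add: partial)
  then show "(norm x)\<^sup>2 \<le> B" by (rule norm_ell2_le)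
qed

lemma summable_coord: "summable (\<lambda>n. (norm (coord x n))\<^sup>2)"
  using square_summable_coord[of x]
  by (simp add: square_summable_def summable_on_UNIV_nonneg_real_iff)

lift_definition single :: "'i \<Rightarrow> 'a::complex_inner \<Rightarrow> ('i, 'a) ell2" is "\<lambda>i h j. if j = i then h else 0"
  subgoal for i by (rule square_summable_finite_support[of "{i}"]) simp_all
  done

declare single.rep_eq [simp]

lemma norm_single: "norm (single i h) = norm h"
  using norm_square_ell2_finite_support[of "{i}" "single i h"] by simp

definition ell2_map :: "('a \<Rightarrow> 'b) \<Rightarrow> ('i, 'a::complex_inner) ell2 \<Rightarrow> ('i, 'b::complex_inner) ell2" where
  "ell2_map f x = Abs_ell2 (\<lambda>i. f (coord x i))"

lemma coord_ell2_map:
  assumes "bounded_linear f"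
  shows "coord (ell2_map f x) i = f (coord x i)"
proof -
  interpret bounded_linear f by fact
  obtain K where K: "\<And>v. norm (f v) \<le> norm v * K" using bounded by blast
  have "(\<lambda>i. K\<^sup>2 * (norm (coord x i))\<^sup>2) summable_on UNIV"
    using square_summable_coord[of x] unfolding square_summable_def by (rule summable_on_cmult_right)
  then have "square_summable (\<lambda>i. f (coord x i))"
    unfolding square_summable_def
  proof (rule summable_on_comparison_test)
    show "(norm (f (coord x i)))\<^sup>2 \<le> K\<^sup>2 * (norm (coord x i))\<^sup>2" for i
      using power_mono[OF K[of "coord x i"], of 2] by (simp add: power_mult_distrib mult.commute)
  qed simp
  then show ?thesis by (simp add: ell2_map_def coord_Abs_ell2)
qed

lemma coord_ell2_map_funpow:
  fixes f :: "'a::complex_inner \<Rightarrow> 'a"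
  assumes "bounded_linear f"
  shows "coord ((ell2_map f ^^ k) x) i = (f ^^ k) (coord x i)"
  by (induction k) (simp_all add: coord_ell2_map[OF assms])

instantiation prod :: (complex_vector, complex_vector) complex_vector
begin

definition scaleC_prod :: "complex \<Rightarrow> 'a \<times> 'b \<Rightarrow> 'a \<times> 'b" where
  "scaleC_prod c z = (c *\<^sub>C fst z, c *\<^sub>C snd z)"

instance
  by standard
    (simp_all add: scaleC_prod_def prod_eq_iff scaleC_add_left scaleC_add_right scaleC_scaleC scaleR_scaleC)

end

lemma fst_scaleC [simp]: "fst (c *\<^sub>C z) = c *\<^sub>C fst z"
  and snd_scaleC [simp]: "snd (c *\<^sub>C z) = c *\<^sub>C snd z"
  by (simp_all add: scaleC_prod_def)

instantiation prod :: (complex_inner, complex_inner) complex_inner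
begin

definition cinner_prod :: "'a \<times> 'b \<Rightarrow> 'a \<times> 'b \<Rightarrow> complex" where
  "cinner_prod z w = cinner (fst z) (fst w) + cinner (snd z) (snd w)"

instance
proof
  fix x y z :: "'a \<times> 'b" and c :: complex
  have self: "cinner x x = complex_of_real ((norm (fst x))\<^sup>2 + (norm (snd x))\<^sup>2)"
    by (simp add: cinner_prod_def cinner_self)
  show "cinner x y = cnj (cinner y x)"
    unfolding cinner_prod_def complex_cnj_add cinner_commute[symmetric] ..
  show "cinner (x + y) z = cinner x z + cinner y z"
    by (simp add: cinner_prod_def cinner_add_left)
  show "cinner (c *\<^sub>C x) y = c * cinner x y"
    by (simp add: cinner_prod_def cinner_scaleC_left distrib_left)
  show "Im (cinner x x) = 0 \<and> 0 \<le> Re (cinner x x)" by (simp add: self)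
  show "cinner x x = 0 \<longleftrightarrow> x = 0"
    unfolding self of_real_eq_0_iff by (simp add: sum_power2_eq_zero_iff prod_eq_iff)
  show "norm x = sqrt (Re (cinner x x))" by (simp add: self norm_prod_def)
qed

end

section \<open>Combinations of annihilation operators\<close>

locale creation_annihilation =
  fixes C D :: "nat \<Rightarrow> 'a::complex_inner \<Rightarrow> 'a"
  assumes adjoint: "cinner (C k x) y = cinner x (D k y)"
    and anticommutator: "C k (D l x) + D l (C k x) = (if k = l then x else 0)"
begin

lemma adjoint': "cinner (D k x) y = cinner x (C k y)"
  by (metis adjoint cinner_commute)

lemma norm_square_combination:
  assumes "finite A"
  shows "(norm (\<Sum>k\<in>A. c k *\<^sub>C C k x))\<^sup>2 + (norm (\<Sum>k\<in>A. cnj (c k) *\<^sub>C D k x))\<^sup>2 =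
    (\<Sum>k\<in>A. (cmod (c k))\<^sup>2) * (norm x)\<^sup>2"
proof -
  let ?T = "\<Sum>k\<in>A. c k *\<^sub>C C k x" and ?T' = "\<Sum>k\<in>A. cnj (c k) *\<^sub>C D k x"
  have "cinner ?T ?T = (\<Sum>k\<in>A. \<Sum>l\<in>A. c k * cnj (c l) * cinner (D l (C k x)) x)"
    by (simp add: cinner_combination adjoint')
  moreover have "cinner ?T' ?T' = (\<Sum>l\<in>A. \<Sum>k\<in>A. c k * cnj (c l) * cinner (C k (D l x)) x)"
    by (simp add: cinner_combination adjoint mult.commute)
  then have "cinner ?T' ?T' = (\<Sum>k\<in>A. \<Sum>l\<in>A. c k * cnj (c l) * cinner (C k (D l x)) x)"
    by (subst sum.swap)
  ultimately have "cinner ?T ?T + cinner ?T' ?T' =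
      (\<Sum>k\<in>A. \<Sum>l\<in>A. c k * cnj (c l) * cinner (C k (D l x) + D l (C k x)) x)"
    by (simp add: cinner_add_left distrib_left sum.distrib)
  also have "\<dots> = (\<Sum>k\<in>A. \<Sum>l\<in>A. if k = l then c k * cnj (c k) * cinner x x else 0)"
    unfolding anticommutator by (intro sum.cong) auto
  also have "\<dots> = complex_of_real ((\<Sum>k\<in>A. (cmod (c k))\<^sup>2) * (norm x)\<^sup>2)"
    using assms by (simp add: sum_distrib_right complex_norm_square cinner_self del: of_real_power)
  finally have "complex_of_real ((norm ?T)\<^sup>2 + (norm ?T')\<^sup>2) =
      complex_of_real ((\<Sum>k\<in>A. (cmod (c k))\<^sup>2) * (norm x)\<^sup>2)"
    by (simp only: cinner_self of_real_add)
  then show ?thesis by (simp only: of_real_eq_iff)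
qed

lemma norm_square_C_D: "(norm (C k x))\<^sup>2 + (norm (D k x))\<^sup>2 = (norm x)\<^sup>2"
  using norm_square_combination[of "{k}" "\<lambda>_. 1" x] by simp

lemma norm_C_le: "norm (C k x) \<le> norm x" and norm_D_le: "norm (D k x) \<le> norm x"
proof -
  have "(norm (C k x))\<^sup>2 \<le> (norm x)\<^sup>2" "(norm (D k x))\<^sup>2 \<le> (norm x)\<^sup>2"
    using norm_square_C_D[of k x] zero_le_power2[of "norm (C k x)"] zero_le_power2[of "norm (D k x)"]
    by linarith+
  then show "norm (C k x) \<le> norm x" "norm (D k x) \<le> norm x" by (auto intro: power2_le_imp_le)
qed

lemma bounded_clinear_C: "bounded_clinear (C k)"
proof (rule bounded_clinear_intro)
  show "C k (x + y) = C k x + C k y" for x y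
    by (rule cinner_eqI) (simp add: adjoint cinner_add_left)
  show "C k (c *\<^sub>C x) = c *\<^sub>C C k x" for c x
    by (rule cinner_eqI) (simp add: adjoint cinner_scaleC_left)
  show "norm (C k x) \<le> 1 * norm x" for x by (simp add: norm_C_le)
qed

lemma bounded_clinear_D: "bounded_clinear (D k)"
proof (rule bounded_clinear_intro)
  show "D k (x + y) = D k x + D k y" for x y
    by (rule cinner_eqI) (simp add: adjoint' cinner_add_left)
  show "D k (c *\<^sub>C x) = c *\<^sub>C D k x" for c x
    by (rule cinner_eqI) (simp add: adjoint' cinner_scaleC_left)
  show "norm (D k x) \<le> 1 * norm x" for x by (simp add: norm_D_le)
qed

sublocale C: bounded_clinear "C k" for k by (rule bounded_clinear_C)

sublocale D: bounded_clinear "D k" for k by (rule bounded_clinear_D)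

end

section \<open>Parseval's identity on the roots of unity\<close>

lemma orthogonality_roots_unity:
  assumes m: "m < N" and n: "n < N"
  shows "(\<Sum>z | z ^ N = 1. z ^ m * cnj z ^ n) = (if m = n then of_nat N else 0 :: complex)"
proof -
  define \<zeta> where "\<zeta> j = cis (2 * pi * real j / real N)" for j
  have bij: "bij_betw \<zeta> {..<N} {z. z ^ N = 1}"
    unfolding \<zeta>_def by (rule Complex.bij_betw_roots_unity) (use m in simp)
  define w where "w = \<zeta> m * cnj (\<zeta> n)"
  have pow: "\<zeta> j ^ i = \<zeta> i ^ j" for i j
    by (simp add: \<zeta>_def Complex.DeMoivre mult_ac)
  have "\<zeta> j ^ m * cnj (\<zeta> j) ^ n = w ^ j" for j
    by (simp add: w_def power_mult_distrib pow[of j] flip: complex_cnj_power)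
  then have sum: "(\<Sum>z | z ^ N = 1. z ^ m * cnj z ^ n) = (\<Sum>j<N. w ^ j)"
    by (simp flip: sum.reindex_bij_betw[OF bij])
  have unit: "\<zeta> n * cnj (\<zeta> n) = 1" by (simp add: \<zeta>_def cis_cnj cis_mult)
  show ?thesis
  proof (cases "m = n")
    case True
    then show ?thesis unfolding sum using unit by (simp add: w_def)
  next
    case False
    have "\<zeta> m \<noteq> \<zeta> n" using bij m n False by (auto simp: bij_betw_def inj_on_def)
    moreover have "cnj (\<zeta> n) \<noteq> 0" by (simp add: \<zeta>_def)
    ultimately have "w \<noteq> 1"
      using unit mult_right_cancel[of "cnj (\<zeta> n)" "\<zeta> m" "\<zeta> n"] by (simp add: w_def)
    have "\<zeta> j ^ N = 1" if "j < N" for j using bij_betwE[OF bij] that by blast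
    then have "w ^ N = 1"
      using m n by (simp add: w_def power_mult_distrib flip: complex_cnj_power)
    then show ?thesis unfolding sum using geometric_sum[OF \<open>w \<noteq> 1\<close>, of N] False by simp
  qed
qed

lemma Parseval_roots_unity:
  fixes y :: "nat \<Rightarrow> 'a::complex_inner"
  shows "(\<Sum>z | z ^ N = 1. (norm (\<Sum>m<N. z ^ m *\<^sub>C y m))\<^sup>2) = real N * (\<Sum>m<N. (norm (y m))\<^sup>2)"
proof -
  let ?Z = "{z::complex. z ^ N = 1}"
  have "complex_of_real (\<Sum>z\<in>?Z. (norm (\<Sum>m<N. z ^ m *\<^sub>C y m))\<^sup>2) =
      (\<Sum>z\<in>?Z. \<Sum>m<N. \<Sum>n<N. z ^ m * cnj z ^ n * cinner (y m) (y n))"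
    unfolding of_real_sum cinner_self[symmetric]
    by (simp add: cinner_combination)
  also have "\<dots> = (\<Sum>m<N. \<Sum>n<N. \<Sum>z\<in>?Z. z ^ m * cnj z ^ n * cinner (y m) (y n))"
    by (subst sum.swap, intro sum.cong refl, rule sum.swap)
  also have "\<dots> = (\<Sum>m<N. \<Sum>n<N. if m = n then of_nat N * cinner (y m) (y m) else 0)"
    by (intro sum.cong) (auto simp: orthogonality_roots_unity simp flip: sum_distrib_right)
  also have "\<dots> = complex_of_real (real N * (\<Sum>m<N. (norm (y m))\<^sup>2))"
    by (simp add: sum_distrib_left cinner_self)
  finally show ?thesis by (simp only: of_real_eq_iff)
qed

lemma (in creation_annihilation) fourier_convolution:
  assumes "cmod \<omega> = 1" and z: "\<And>m. m < d \<or> N \<le> m \<Longrightarrow> z m = 0"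
  shows "(\<Sum>m<N. \<omega> ^ m *\<^sub>C (\<Sum>k<d. c k *\<^sub>C C k (z (m + k)))) =
    (\<Sum>k<d. (c k * cnj \<omega> ^ k) *\<^sub>C C k (\<Sum>m<N. \<omega> ^ m *\<^sub>C z m))"
proof -
  have unit: "cnj \<omega> * \<omega> = 1" using complex_norm_square[of \<omega>] assms(1) by (simp add: mult.commute)
  have shift: "(\<Sum>m<N. \<omega> ^ m *\<^sub>C z (m + k)) = cnj \<omega> ^ k *\<^sub>C (\<Sum>m<N. \<omega> ^ m *\<^sub>C z m)" if "k < d" for k
  proof -
    have "cnj \<omega> ^ k * \<omega> ^ (m + k) = (cnj \<omega> * \<omega>) ^ k * \<omega> ^ m" for m
      by (simp only: power_add power_mult_distrib mult_ac)
    then have "cnj \<omega> ^ k * \<omega> ^ (m + k) = \<omega> ^ m" for m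
      by (simp only: unit power_one mult_1)
    then have "(\<Sum>m<N. \<omega> ^ m *\<^sub>C z (m + k)) = cnj \<omega> ^ k *\<^sub>C (\<Sum>m<N. \<omega> ^ (m + k) *\<^sub>C z (m + k))"
      by (simp add: scaleC_right.sum scaleC_scaleC)
    also have "(\<Sum>m<N. \<omega> ^ (m + k) *\<^sub>C z (m + k)) = (\<Sum>m\<in>{k..<N + k}. \<omega> ^ m *\<^sub>C z m)"
      using sum.shift_bounds_nat_ivl[of "\<lambda>m. \<omega> ^ m *\<^sub>C z m" 0 k N] by (simp add: atLeast0LessThan)
    also have "\<dots> = (\<Sum>m<N. \<omega> ^ m *\<^sub>C z m)"
      using that by (intro sum.mono_neutral_cong) (auto simp: z)
    finally show ?thesis .
  qed
  have "(\<Sum>m<N. \<omega> ^ m *\<^sub>C (\<Sum>k<d. c k *\<^sub>C C k (z (m + k)))) =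
      (\<Sum>k<d. c k *\<^sub>C C k (\<Sum>m<N. \<omega> ^ m *\<^sub>C z (m + k)))"
    by (simp add: scaleC_right.sum C.scaleC_sum scaleC_scaleC mult.commute) (rule sum.swap)
  also have "\<dots> = (\<Sum>k<d. (c k * cnj \<omega> ^ k) *\<^sub>C C k (\<Sum>m<N. \<omega> ^ m *\<^sub>C z m))"
    by (simp add: shift C.scaleC scaleC_scaleC)
  finally show ?thesis .
qed

section \<open>Von Neumann's inequality with anticommuting coefficients\<close>

text \<open>The orbit map \<open>x \<mapsto> (Q\<^sup>m x)\<^sub>m\<close> is isometric for the defect, up to the remainder \<open>\<parallel>Q\<^sup>n x\<parallel>\<^sup>2\<close>,
  and turns \<open>Q\<close> into a shift. This replaces the isometric dilation of \<open>Q\<close>.\<close>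

definition defect :: "('a::real_normed_vector \<Rightarrow> 'b::real_normed_vector) \<Rightarrow> 'a \<Rightarrow> real" where
  "defect Q x = (norm x)\<^sup>2 - (norm (Q x))\<^sup>2"

lemma sum_defect_orbit: "(\<Sum>m<n. defect Q ((Q ^^ m) x)) = (norm x)\<^sup>2 - (norm ((Q ^^ n) x))\<^sup>2"
  by (induction n) (simp_all add: defect_def)

lemma (in bounded_clinear) Parseval_defect:
  "(\<Sum>z | z ^ N = 1. defect f (\<Sum>m<N. z ^ m *\<^sub>C y m)) = real N * (\<Sum>m<N. defect f (y m))"
  by (simp add: defect_def sum_subtractf scaleC_sum Parseval_roots_unity right_diff_distrib)

locale commuting_contraction = creation_annihilation C D + Q: bounded_clinear Q
  for C D :: "nat \<Rightarrow> 'a::complex_inner \<Rightarrow> 'a" and Q :: "'a \<Rightarrow> 'a" +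
  assumes contraction: "norm (Q x) \<le> norm x"
    and Q_C: "Q (C k x) = C k (Q x)"
    and Q_D: "Q (D k x) = D k (Q x)"
begin

lemma defect_nonneg: "0 \<le> defect Q x"
  by (simp add: defect_def contraction power_mono)

lemma funpow_Q_C: "(Q ^^ n) (C k x) = C k ((Q ^^ n) x)"
  by (induction n) (simp_all add: Q_C)

lemma defect_combination_le:
  assumes "finite A"
  shows "defect Q (\<Sum>k\<in>A. c k *\<^sub>C C k x) \<le> (\<Sum>k\<in>A. (cmod (c k))\<^sup>2) * defect Q x"
proof -
  have "defect Q (\<Sum>k\<in>A. c k *\<^sub>C C k x) + defect Q (\<Sum>k\<in>A. cnj (c k) *\<^sub>C D k x) =
      (\<Sum>k\<in>A. (cmod (c k))\<^sup>2) * defect Q x"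
    using norm_square_combination[OF assms, of c x] norm_square_combination[OF assms, of c "Q x"]
    by (simp add: defect_def Q.scaleC_sum Q_C Q_D right_diff_distrib)
  then show ?thesis using defect_nonneg[of "\<Sum>k\<in>A. cnj (c k) *\<^sub>C D k x"] by simp
qed

lemma sum_defect_convolution_le:
  assumes z: "\<And>m. m < d \<or> N \<le> m \<Longrightarrow> z m = 0"
  shows "(\<Sum>m<N. defect Q (\<Sum>k<d. c k *\<^sub>C C k (z (m + k)))) \<le>
    (\<Sum>k<d. (cmod (c k))\<^sup>2) * (\<Sum>m<N. defect Q (z m))"
proof (cases "N = 0")
  case False
  define y where "y m = (\<Sum>k<d. c k *\<^sub>C C k (z (m + k)))" for m
  have defect_fourier_le: "defect Q (\<Sum>m<N. \<omega> ^ m *\<^sub>C y m) \<le>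
      (\<Sum>k<d. (cmod (c k))\<^sup>2) * defect Q (\<Sum>m<N. \<omega> ^ m *\<^sub>C z m)" if "\<omega> ^ N = 1" for \<omega>
  proof -
    have unit: "cmod \<omega> = 1" using power_eq_1_iff[OF that] False by simp
    have "(\<Sum>m<N. \<omega> ^ m *\<^sub>C y m) = (\<Sum>k<d. (c k * cnj \<omega> ^ k) *\<^sub>C C k (\<Sum>m<N. \<omega> ^ m *\<^sub>C z m))"
      unfolding y_def by (rule fourier_convolution[OF unit]) (rule z)
    then show ?thesis
      using defect_combination_le[of "{..<d}" "\<lambda>k. c k * cnj \<omega> ^ k" "\<Sum>m<N. \<omega> ^ m *\<^sub>C z m"]
      by (simp add: norm_mult norm_power unit)
  qed
  have "real N * (\<Sum>m<N. defect Q (y m)) = (\<Sum>\<omega> | \<omega> ^ N = 1. defect Q (\<Sum>m<N. \<omega> ^ m *\<^sub>C y m))"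
    by (rule Q.Parseval_defect[symmetric])
  also have "\<dots> \<le> (\<Sum>\<omega> | \<omega> ^ N = 1. (\<Sum>k<d. (cmod (c k))\<^sup>2) * defect Q (\<Sum>m<N. \<omega> ^ m *\<^sub>C z m))"
    by (intro sum_mono defect_fourier_le) simp
  also have "\<dots> = real N * ((\<Sum>k<d. (cmod (c k))\<^sup>2) * (\<Sum>m<N. defect Q (z m)))"
    by (simp add: Q.Parseval_defect flip: sum_distrib_left)
  finally show ?thesis using False by (simp add: y_def)
qed simp

lemma norm_combination_orbit_le:
  defines "T \<equiv> \<lambda>c d x. \<Sum>k<d. c k *\<^sub>C C k ((Q ^^ k) x)"
  shows "(norm (T c d x))\<^sup>2 \<le> (\<Sum>k<d. (cmod (c k))\<^sup>2) * (norm x)\<^sup>2 + (norm ((Q ^^ M) (T c d x)))\<^sup>2"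
proof -
  define N where "N = d + (M + d)"
  define z where "z m = (if d \<le> m \<and> m < N then (Q ^^ (m - d)) x else 0)" for m
  define y where "y m = (\<Sum>k<d. c k *\<^sub>C C k (z (m + k)))" for m
  interpret Q_pow: bounded_clinear "Q ^^ m" for m by (rule bounded_clinear_funpow) unfold_locales
  have y: "y (m + d) = (Q ^^ m) (T c d x)" if "m < M" for m
    using that by (simp add: y_def z_def N_def T_def Q_pow.scaleC_sum funpow_Q_C funpow_add)
  have sum_z: "(\<Sum>m<N. defect Q (z m)) = (norm x)\<^sup>2 - (norm ((Q ^^ (M + d)) x))\<^sup>2"
  proof -
    have "(\<Sum>m<N. defect Q (z m)) = (\<Sum>m\<in>{d..<N}. defect Q (z m))"
      by (rule sum.mono_neutral_right) (auto simp: z_def defect_def)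
    also have "\<dots> = (\<Sum>m<M + d. defect Q ((Q ^^ m) x))"
      using sum.shift_bounds_nat_ivl[of "\<lambda>m. defect Q (z m)" 0 d "M + d"]
      by (simp add: N_def z_def atLeast0LessThan add.commute)
    finally show ?thesis by (simp add: sum_defect_orbit)
  qed
  have "(norm (T c d x))\<^sup>2 - (norm ((Q ^^ M) (T c d x)))\<^sup>2 = (\<Sum>m<M. defect Q (y (m + d)))"
    unfolding sum_defect_orbit[symmetric] by (intro sum.cong) (simp_all add: y)
  also have "\<dots> = (\<Sum>m\<in>{d..<M + d}. defect Q (y m))"
    using sum.shift_bounds_nat_ivl[of "\<lambda>m. defect Q (y m)" 0 d M] by (simp add: atLeast0LessThan)
  also have "\<dots> \<le> (\<Sum>m<N. defect Q (y m))"
    by (intro sum_mono2) (auto simp: N_def defect_nonneg)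
  also have "\<dots> \<le> (\<Sum>k<d. (cmod (c k))\<^sup>2) * (\<Sum>m<N. defect Q (z m))"
    unfolding y_def by (rule sum_defect_convolution_le) (auto simp: z_def)
  also have "\<dots> \<le> (\<Sum>k<d. (cmod (c k))\<^sup>2) * (norm x)\<^sup>2"
    unfolding sum_z by (intro mult_left_mono sum_nonneg) simp_all
  finally show ?thesis by simp
qed

lemma norm_combination_powers_le_strict:
  assumes r: "0 \<le> r" "r < 1" and strict: "\<And>x. norm (Q x) \<le> r * norm x"
  shows "(norm (\<Sum>k<d. c k *\<^sub>C C k ((Q ^^ k) x)))\<^sup>2 \<le> (\<Sum>k<d. (cmod (c k))\<^sup>2) * (norm x)\<^sup>2"
proof -
  let ?T = "\<Sum>k<d. c k *\<^sub>C C k ((Q ^^ k) x)" and ?B = "(\<Sum>k<d. (cmod (c k))\<^sup>2) * (norm x)\<^sup>2"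
  have pow: "norm ((Q ^^ M) v) \<le> r ^ M * norm v" for M v
  proof (induction M)
    case (Suc M)
    have "norm (Q ((Q ^^ M) v)) \<le> r * norm ((Q ^^ M) v)" by (rule strict)
    also have "\<dots> \<le> r * (r ^ M * norm v)" using Suc r by (intro mult_left_mono)
    finally show ?case by (simp add: mult.assoc)
  qed simp
  have "(\<lambda>M. ?B + (r ^ M * norm ?T)\<^sup>2) \<longlonglongrightarrow> ?B + (0 * norm ?T)\<^sup>2"
    using r by (intro tendsto_intros LIMSEQ_power_zero) simp
  moreover have "(norm ?T)\<^sup>2 \<le> ?B + (r ^ M * norm ?T)\<^sup>2" for M
    using norm_combination_orbit_le[where c = c and d = d and x = x and M = M] power_mono[OF pow[of M ?T], of 2]
    by simp
  ultimately show ?thesis by (intro LIMSEQ_le_const) auto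
qed

theorem norm_combination_powers_le:
  "(norm (\<Sum>k<d. c k *\<^sub>C C k ((Q ^^ k) x)))\<^sup>2 \<le> (\<Sum>k<d. (cmod (c k))\<^sup>2) * (norm x)\<^sup>2"
proof (rule tendsto_lowerbound)
  let ?T = "\<Sum>k<d. c k *\<^sub>C C k ((Q ^^ k) x)"
  show "((\<lambda>r. (\<Sum>k<d. (cmod (c k) / r ^ k)\<^sup>2) * (norm x)\<^sup>2) \<longlongrightarrow> (\<Sum>k<d. (cmod (c k))\<^sup>2) * (norm x)\<^sup>2) (at_left 1)"
    by (auto intro!: tendsto_eq_intros)
  have "(norm ?T)\<^sup>2 \<le> (\<Sum>k<d. (cmod (c k) / r ^ k)\<^sup>2) * (norm x)\<^sup>2" if r: "0 < r" "r < 1" for r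
  proof -
    let ?Q = "\<lambda>v. complex_of_real r *\<^sub>C Q v"
    interpret rQ: commuting_contraction C D ?Q
    proof (intro commuting_contraction.intro commuting_contraction_axioms.intro)
      show "bounded_clinear ?Q"
        by (intro bounded_clinear_compose[OF bounded_clinear_scaleC]) unfold_locales
      show "norm (?Q v) \<le> norm v" for v
        using r contraction[of v] mult_left_le_one_le[of "norm (Q v)" r] by (simp add: norm_scaleC)
    qed (unfold_locales, simp_all add: Q_C Q_D C.scaleC D.scaleC)
    have pow: "(?Q ^^ k) v = complex_of_real r ^ k *\<^sub>C (Q ^^ k) v" for k v
      by (induction k) (simp_all add: Q.scaleC scaleC_scaleC)
    have "norm (?Q v) \<le> r * norm v" for v
      using r contraction[of v] by (simp add: norm_scaleC)
    from rQ.norm_combination_powers_le_strict[OF _ r(2) this, where c = "\<lambda>k. c k / complex_of_real r ^ k"] r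
    show ?thesis by (simp add: pow C.scaleC scaleC_scaleC norm_divide norm_power)
  qed
  then show "\<forall>\<^sub>F r in at_left 1. (norm ?T)\<^sup>2 \<le> (\<Sum>k<d. (cmod (c k) / r ^ k)\<^sup>2) * (norm x)\<^sup>2"
    by (intro eventually_at_leftI[of 0]) simp_all
qed simp

end

section \<open>Hankel matrices of annihilation operators\<close>

lemma (in creation_annihilation) Hankel_section_bound:
  "(\<Sum>i<N. (norm (\<Sum>j<n. c (i + j) *\<^sub>C C (i + j) (x j)))\<^sup>2) \<le>
    (\<Sum>k<N + n. (cmod (c k))\<^sup>2) * (\<Sum>j<n. (norm (x j))\<^sup>2)"
proof -
  have "bounded_clinear (\<lambda>_::'a. 0::'a)"
    by (rule bounded_clinear_intro[where K = 0]) simp_all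
  then have zero: "commuting_contraction C D (\<lambda>_. 0)"
    by (intro commuting_contraction.intro creation_annihilation_axioms commuting_contraction_axioms.intro)
      (simp_all add: C.zero D.zero)
  define d where "d = N + n"
  define L where "L = Suc (d + n)"
  define z where "z m = (if d \<le> m \<and> m < d + n then x (m - d) else 0)" for m
  have z_support: "z m = 0" if "m < d \<or> L \<le> m" for m using that by (auto simp: z_def L_def)
  define y where "y m = (\<Sum>k<d. c k *\<^sub>C C k (z (m + k)))" for m
  have row: "(\<Sum>j<n. c (i + j) *\<^sub>C C (i + j) (x j)) = y (d - i)" if "i < N" for i
  proof -
    have "i \<le> d" and sub: "{i..<n + i} \<subseteq> {..<d}" using that by (auto simp: d_def)
    have z_row: "z (d - i + k) = (if i \<le> k \<and> k < n + i then x (k - i) else 0)" for k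
      using \<open>i \<le> d\<close> by (auto simp: z_def)
    have "y (d - i) = (\<Sum>k\<in>{i..<n + i}. c k *\<^sub>C C k (z (d - i + k)))"
      unfolding y_def using sub by (intro sum.mono_neutral_right) (auto simp: z_row C.zero)
    also have "\<dots> = (\<Sum>j<n. c (i + j) *\<^sub>C C (i + j) (x j))"
      using sum.shift_bounds_nat_ivl[of "\<lambda>k. c k *\<^sub>C C k (z (d - i + k))" 0 i n]
      by (simp add: z_row atLeast0LessThan add.commute)
    finally show ?thesis by (rule sym)
  qed
  have "(\<Sum>i<N. (norm (\<Sum>j<n. c (i + j) *\<^sub>C C (i + j) (x j)))\<^sup>2) = (\<Sum>i<N. (norm (y (d - i)))\<^sup>2)"
    by (intro sum.cong) (simp_all only: row lessThan_iff)
  also have "\<dots> = (\<Sum>m\<in>(\<lambda>i. d - i) ` {..<N}. (norm (y m))\<^sup>2)"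
    by (subst sum.reindex) (auto simp: inj_on_def d_def)
  also have "\<dots> \<le> (\<Sum>m<L. (norm (y m))\<^sup>2)"
    by (intro sum_mono2) (auto simp: L_def)
  also have "\<dots> \<le> (\<Sum>k<d. (cmod (c k))\<^sup>2) * (\<Sum>m<L. (norm (z m))\<^sup>2)"
    using commuting_contraction.sum_defect_convolution_le[OF zero z_support] by (simp add: y_def defect_def)
  also have "(\<Sum>m<L. (norm (z m))\<^sup>2) = (\<Sum>m\<in>{d..<n + d}. (norm (z m))\<^sup>2)"
    by (rule sum.mono_neutral_right) (auto simp: z_def L_def)
  also have "\<dots> = (\<Sum>j<n. (norm (x j))\<^sup>2)"
    using sum.shift_bounds_nat_ivl[of "\<lambda>m. (norm (z m))\<^sup>2" 0 d n] by (simp add: z_def atLeast0LessThan add.commute)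
  finally show ?thesis by (simp add: d_def)
qed

section \<open>A matrix model of the anticommutation relations\<close>

text \<open>Counting the elements below \<open>k\<close> keeps the sign meaningful for infinite \<open>J\<close>.\<close>

definition fermion_sign :: "nat \<Rightarrow> nat set \<Rightarrow> complex" where
  "fermion_sign k J = (-1) ^ card {l \<in> J. l < k}"

lemma fermion_sign_mult_self [simp]: "fermion_sign k J * fermion_sign k J = 1"
  by (simp add: fermion_sign_def flip: power_mult_distrib)

lemma cnj_fermion_sign [simp]: "cnj (fermion_sign k J) = fermion_sign k J"
  by (simp add: fermion_sign_def)

lemma norm_fermion_sign_scaleC [simp]: "norm (fermion_sign k J *\<^sub>C x) = norm (x :: 'a::complex_inner)"
  by (simp add: fermion_sign_def norm_scaleC norm_power)

lemma fermion_sign_insert: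
  assumes "l \<notin> J"
  shows "fermion_sign k (insert l J) = (if l < k then - fermion_sign k J else fermion_sign k J)"
proof -
  have "{i \<in> insert l J. i < k} = (if l < k then insert l {i \<in> J. i < k} else {i \<in> J. i < k})"
    by auto
  then show ?thesis using assms by (simp add: fermion_sign_def)
qed

lift_definition annihilator :: "nat \<Rightarrow> (nat set, 'a::complex_inner) ell2 \<Rightarrow> (nat set, 'a) ell2"
  is "\<lambda>k f J. if k \<in> J then 0 else fermion_sign k J *\<^sub>C f (insert k J)"
  subgoal for k f
    by (rule square_summable_reindex[of f "insert k" "{J. k \<notin> J}"]) (auto simp: inj_on_def)
  done

lift_definition creator :: "nat \<Rightarrow> (nat set, 'a::complex_inner) ell2 \<Rightarrow> (nat set, 'a) ell2"
  is "\<lambda>k f J. if k \<in> J then fermion_sign k J *\<^sub>C f (J - {k}) else 0"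
  subgoal for k f
    by (rule square_summable_reindex[of f "\<lambda>J. J - {k}" "{J. k \<in> J}"]) (auto simp: inj_on_def)
  done

declare annihilator.rep_eq [simp] creator.rep_eq [simp]

lemma cinner_annihilator: "cinner (annihilator k x) y = cinner x (creator k y)"
proof -
  have "cinner (annihilator k x) y =
      (\<Sum>\<^sub>\<infinity>J\<in>{J. k \<notin> J}. cinner (fermion_sign k J *\<^sub>C coord x (insert k J)) (coord y J))"
    unfolding cinner_ell2_def by (rule infsum_cong_neutral) auto
  also have "\<dots> = (\<Sum>\<^sub>\<infinity>J\<in>{J. k \<in> J}. cinner (coord x J) (fermion_sign k J *\<^sub>C coord y (J - {k})))"
    by (rule infsum_reindex_bij_witness[of _ "\<lambda>J. J - {k}" "insert k"])
      (auto simp: cinner_scaleC_left cinner_scaleC_right fermion_sign_insert insert_absorb)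
  also have "\<dots> = cinner x (creator k y)"
    unfolding cinner_ell2_def by (rule infsum_cong_neutral) auto
  finally show ?thesis .
qed

lemma annihilator_creator_anticommute:
  "annihilator k (creator l x) + creator l (annihilator k x) = (if k = l then x else 0)"
proof (rule ell2_eqI)
  fix J
  have remove: "fermion_sign i J = (if m < i then - fermion_sign i (J - {m}) else fermion_sign i (J - {m}))"
    if "m \<in> J" for i m
    using fermion_sign_insert[of m "J - {m}" i] that by (simp add: insert_absorb)
  have sets: "insert k J - {l} = insert k (J - {l})" if "k \<noteq> l" using that by auto
  show "coord (annihilator k (creator l x) + creator l (annihilator k x)) J = coord (if k = l then x else 0) J"
  proof (cases "k = l")
    case True
    then show ?thesis
      by (auto simp: scaleC_scaleC insert_absorb fermion_sign_insert remove[of l l])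
  next
    case False
    then show ?thesis
      by (auto simp: scaleC_scaleC fermion_sign_insert remove[of l k] sets mult.commute
          simp flip: scaleC_left.add)
  qed
qed

lemma creation_annihilation_model: "creation_annihilation annihilator creator"
  by unfold_locales (rule cinner_annihilator annihilator_creator_anticommute)+

lemma commuting_contraction_ell2_map:
  assumes "bounded_clinear P" and contraction: "\<And>x. norm (P x) \<le> norm x"
  shows "commuting_contraction annihilator creator (ell2_map P)"
proof -
  interpret P: bounded_clinear P by fact
  note coord_map = coord_ell2_map[OF P.bounded_linear_axioms]
  have le: "norm (ell2_map P x) \<le> norm x" for x :: "('i, 'a) ell2"
  proof (rule power2_le_imp_le, rule norm_ell2_le)
    fix F :: "'i set" assume "finite F"
    have "(\<Sum>i\<in>F. (norm (coord (ell2_map P x) i))\<^sup>2) \<le> (\<Sum>i\<in>F. (norm (coord x i))\<^sup>2)"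
      unfolding coord_map by (intro sum_mono power_mono contraction) simp
    also have "\<dots> \<le> (norm x)\<^sup>2" by (rule sum_coord_le_norm[OF \<open>finite F\<close>])
    finally show "(\<Sum>i\<in>F. (norm (coord (ell2_map P x) i))\<^sup>2) \<le> (norm x)\<^sup>2" .
  qed simp
  have "bounded_clinear (ell2_map P :: (nat set, 'a) ell2 \<Rightarrow> _)"
    using le by (intro bounded_clinear_intro[where K = 1] ell2_eqI)
      (simp_all add: coord_map P.add P.scaleC)
  then show ?thesis
    by (intro commuting_contraction.intro creation_annihilation_model
        commuting_contraction_axioms.intro le ell2_eqI) (simp_all add: coord_map P.scaleC P.zero)
qed

definition fermionic_sum ::
    "nat \<Rightarrow> (nat \<Rightarrow> complex) \<Rightarrow> (nat \<Rightarrow> 'a \<Rightarrow> 'b::complex_inner) \<Rightarrow> (nat set \<Rightarrow> 'a) \<Rightarrow> nat set \<Rightarrow> 'b" where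
  "fermionic_sum d c F x J = (\<Sum>k\<in>{..<d} - J. (c k * fermion_sign k J) *\<^sub>C F k (x (insert k J)))"

definition fock_norm_square :: "nat \<Rightarrow> (nat set \<Rightarrow> 'a::real_normed_vector) \<Rightarrow> real" where
  "fock_norm_square d x = (\<Sum>J\<in>Pow {..<d}. (norm (x J))\<^sup>2)"

lemma fock_norm_square_le:
  assumes "\<And>J. J \<subseteq> {..<d} \<Longrightarrow> norm (x J) \<le> K * norm (y J)"
  shows "fock_norm_square d x \<le> K\<^sup>2 * fock_norm_square d y"
  unfolding fock_norm_square_def sum_distrib_left power_mult_distrib[symmetric]
  by (intro sum_mono power_mono assms) auto

lemma (in bounded_clinear) fermionic_sum_image:
  "f (fermionic_sum d c F x J) = fermionic_sum d c (\<lambda>k v. f (F k v)) x J"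
  by (simp add: fermionic_sum_def scaleC_sum)

lemma fermionic_von_Neumann_inequality:
  fixes P :: "'a::complex_inner \<Rightarrow> 'a"
  assumes P: "bounded_clinear P" and contraction: "\<And>x. norm (P x) \<le> norm x"
  shows "fock_norm_square d (fermionic_sum d c (\<lambda>k. P ^^ k) x) \<le> (\<Sum>k<d. (cmod (c k))\<^sup>2) * fock_norm_square d x"
proof -
  interpret P: bounded_clinear P by (rule P)
  interpret commuting_contraction annihilator creator "ell2_map P"
    by (rule commuting_contraction_ell2_map[OF assms])
  define X where "X = (\<Sum>J\<in>Pow {..<d}. single J (x J))"
  define T where "T = (\<Sum>k<d. c k *\<^sub>C annihilator k ((ell2_map P ^^ k) X))"
  have coord_X: "coord X J = (if J \<subseteq> {..<d} then x J else 0)" for J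
    by (simp add: X_def coord_sum)
  have coord_T: "coord T J = fermionic_sum d c (\<lambda>k. P ^^ k) x J" if "J \<in> Pow {..<d}" for J
  proof -
    have "coord T J = (\<Sum>k\<in>{..<d} - J. c k *\<^sub>C coord (annihilator k ((ell2_map P ^^ k) X)) J)"
      unfolding T_def coord_sum scaleC_ell2.rep_eq by (rule sum.mono_neutral_right) auto
    also have "\<dots> = fermionic_sum d c (\<lambda>k. P ^^ k) x J"
      unfolding fermionic_sum_def using that
      by (intro sum.cong) (auto simp: coord_ell2_map_funpow[OF P.bounded_linear_axioms] coord_X scaleC_scaleC)
    finally show ?thesis .
  qed
  have "(\<Sum>J\<in>Pow {..<d}. (norm (coord T J))\<^sup>2) \<le> (norm T)\<^sup>2"
    by (rule sum_coord_le_norm) simp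
  also have "\<dots> \<le> (\<Sum>k<d. (cmod (c k))\<^sup>2) * (norm X)\<^sup>2"
    unfolding T_def by (rule norm_combination_powers_le)
  also have "(norm X)\<^sup>2 = (\<Sum>J\<in>Pow {..<d}. (norm (coord X J))\<^sup>2)"
    by (rule norm_square_ell2_finite_support) (auto simp: coord_X)
  finally show ?thesis by (simp add: fock_norm_square_def coord_T coord_X)
qed

definition similar_contraction :: "('a::complex_inner \<Rightarrow> 'a) \<Rightarrow> bool" where
  "similar_contraction R \<longleftrightarrow> (\<exists>T T' :: 'a \<Rightarrow> 'a. bounded_clinear T \<and> bounded_clinear T' \<and>
     (\<forall>x. T (T' x) = x) \<and> (\<forall>x. T' (T x) = x) \<and> (\<forall>x. norm (T' (R (T x))) \<le> norm x))"

theorem similar_contraction_fermionic_bound: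
  fixes R :: "'a::complex_inner \<Rightarrow> 'a"
  assumes R: "bounded_clinear R" and "similar_contraction R"
  obtains M where "0 \<le> M"
    "\<And>d c x. fock_norm_square d (fermionic_sum d c (\<lambda>k. R ^^ k) x) \<le>
      M * (\<Sum>k<d. (cmod (c k))\<^sup>2) * fock_norm_square d x"
proof -
  obtain T T' :: "'a \<Rightarrow> 'a" where T: "bounded_clinear T" and T': "bounded_clinear T'"
    and inv: "\<And>x. T (T' x) = x" and contraction: "\<And>x. norm (T' (R (T x))) \<le> norm x"
    using assms(2) unfolding similar_contraction_def by blast
  interpret T: bounded_clinear T by (rule T)
  interpret T': bounded_clinear T' by (rule T')
  define P where "P x = T' (R (T x))" for x
  have P: "bounded_clinear P"
    unfolding P_def by (rule bounded_clinear_compose[OF T' bounded_clinear_compose[OF R T]])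
  have R_pow: "(R ^^ k) v = T ((P ^^ k) (T' v))" for k v
    by (induction k) (simp_all add: P_def inv)
  obtain B B' where B: "norm (T v) \<le> B * norm v" and B': "norm (T' v) \<le> B' * norm v" for v
    using T.bounded T'.bounded by (metis mult.commute)
  show ?thesis
  proof (rule that[of "B\<^sup>2 * B'\<^sup>2"])
    fix d and c :: "nat \<Rightarrow> complex" and x :: "nat set \<Rightarrow> 'a"
    let ?P = "fermionic_sum d c (\<lambda>k. P ^^ k) (\<lambda>J. T' (x J))"
    have "fermionic_sum d c (\<lambda>k. R ^^ k) x J = T (?P J)" for J
      by (simp add: T.fermionic_sum_image) (simp add: fermionic_sum_def R_pow)
    then have "fock_norm_square d (fermionic_sum d c (\<lambda>k. R ^^ k) x) \<le> B\<^sup>2 * fock_norm_square d ?P"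
      by (intro fock_norm_square_le) (simp add: B)
    also have "\<dots> \<le> B\<^sup>2 * ((\<Sum>k<d. (cmod (c k))\<^sup>2) * fock_norm_square d (\<lambda>J. T' (x J)))"
      by (intro mult_left_mono fermionic_von_Neumann_inequality P) (simp_all add: P_def contraction)
    also have "\<dots> \<le> B\<^sup>2 * ((\<Sum>k<d. (cmod (c k))\<^sup>2) * (B'\<^sup>2 * fock_norm_square d x))"
      by (intro mult_left_mono fock_norm_square_le B' sum_nonneg) simp_all
    finally show "fock_norm_square d (fermionic_sum d c (\<lambda>k. R ^^ k) x) \<le>
        B\<^sup>2 * B'\<^sup>2 * (\<Sum>k<d. (cmod (c k))\<^sup>2) * fock_norm_square d x"
      by (simp add: mult_ac)
  qed simp
qed

section \<open>Fock vectors\<close>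

locale car_family = creation_annihilation C D
  for C D :: "nat \<Rightarrow> 'a::complex_inner \<Rightarrow> 'a" +
  assumes C_anticommute: "C k (C l x) + C l (C k x) = 0"
begin

lemma C_D_anticommute: "k \<noteq> l \<Longrightarrow> C k (D l x) = - D l (C k x)"
  using anticommutator[of k l x] by (simp add: eq_neg_iff_add_eq_0)

lemma vacuum_exists:
  assumes "v \<noteq> (0::'a)"
  obtains \<Omega> where "norm \<Omega> = 1" "\<And>k. k < d \<Longrightarrow> C k \<Omega> = 0"
proof -
  have "\<exists>w. w \<noteq> 0 \<and> (\<forall>k<d. C k w = 0)"
  proof (induction d)
    case 0
    show ?case using assms by auto
  next
    case (Suc d)
    then obtain w where w: "w \<noteq> 0" "\<And>k. k < d \<Longrightarrow> C k w = 0" by blast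
    show ?case
    proof (cases "C d w = 0")
      case True
      then show ?thesis using w by (auto simp: less_Suc_eq)
    next
      case False
      have "C d (C d w) = 0"
        using C_anticommute[of d d w] by (simp flip: scaleR_2)
      moreover have "C k (C d w) = 0" if "k < d" for k
        using C_anticommute[of k d w] w(2)[OF that] by simp
      ultimately show ?thesis using False by (auto simp: less_Suc_eq)
    qed
  qed
  then obtain w where w: "w \<noteq> 0" "\<And>k. k < d \<Longrightarrow> C k w = 0" by blast
  then show ?thesis
    by (intro that[of "complex_of_real (inverse (norm w)) *\<^sub>C w"]) (simp_all add: norm_scaleC norm_inverse C.scaleC)
qed

lemma C_foldr_D_zero:
  "C k \<Omega> = 0 \<Longrightarrow> k \<notin> set ks \<Longrightarrow> C k (foldr D ks \<Omega>) = 0"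
  by (induction ks) (simp_all add: C_D_anticommute)

lemma C_foldr_D_append:
  assumes "C k \<Omega> = 0" "k \<notin> set ks" "k \<notin> set ls"
  shows "C k (foldr D (ks @ k # ls) \<Omega>) = (-1) ^ length ks *\<^sub>C foldr D (ks @ ls) \<Omega>"
  using assms(2)
proof (induction ks)
  case Nil
  show ?case
    using anticommutator[of k k "foldr D ls \<Omega>"] by (simp add: C_foldr_D_zero[OF assms(1,3)])
next
  case (Cons l ks)
  then show ?case by (simp add: C_D_anticommute D.scaleC scaleC_left.minus)
qed

definition fock :: "'a \<Rightarrow> nat set \<Rightarrow> 'a" where
  "fock \<Omega> J = foldr D (sorted_list_of_set J) \<Omega>"

lemma norm_fock:
  assumes "\<And>k. k \<in> J \<Longrightarrow> C k \<Omega> = 0" "finite J"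
  shows "norm (fock \<Omega> J) = norm \<Omega>"
proof -
  have "norm (foldr D ks \<Omega>) = norm \<Omega>" if "distinct ks" "set ks \<subseteq> J" for ks
    using that
  proof (induction ks)
    case (Cons k ks)
    then have "C k (foldr D ks \<Omega>) = 0" by (intro C_foldr_D_zero assms(1)) auto
    then have "norm (D k (foldr D ks \<Omega>)) = norm (foldr D ks \<Omega>)"
      using norm_square_C_D[of k "foldr D ks \<Omega>"] by simp
    with Cons show ?case by simp
  qed simp
  then show ?thesis using assms(2) by (simp add: fock_def)
qed

lemma C_fock_insert:
  assumes "C k \<Omega> = 0" "finite J" "k \<notin> J"
  shows "C k (fock \<Omega> (insert k J)) = fermion_sign k J *\<^sub>C fock \<Omega> J"
proof -
  let ?L = "sorted_list_of_set {l \<in> J. l < k}" and ?G = "sorted_list_of_set {l \<in> J. k < l}"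
  have "sorted_list_of_set (insert k J) = ?L @ k # ?G"
  proof (rule strict_sorted_equal[OF _ strict_sorted_list_of_set])
    show "sorted_wrt (<) (?L @ k # ?G)" using assms(2) by (auto simp: sorted_wrt_append)
    show "set (sorted_list_of_set (insert k J)) = set (?L @ k # ?G)"
      using assms(2) by (auto simp del: sorted_list_of_set_insert_remove)
  qed
  moreover have "sorted_list_of_set J = ?L @ ?G"
  proof (rule strict_sorted_equal[OF _ strict_sorted_list_of_set])
    show "sorted_wrt (<) (?L @ ?G)" using assms(2) by (auto simp: sorted_wrt_append)
    show "set (sorted_list_of_set J) = set (?L @ ?G)" using assms(2,3) by (auto simp: not_less_iff_gr_or_eq)
  qed
  moreover have "C k (foldr D (?L @ k # ?G) \<Omega>) = (-1) ^ length ?L *\<^sub>C foldr D (?L @ ?G) \<Omega>"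
    using assms by (intro C_foldr_D_append) simp_all
  ultimately show ?thesis
    by (simp add: fock_def fermion_sign_def)
qed

end

section \<open>The Fock space test\<close>

lemma sum_Pow_complement_ge:
  fixes f :: "'a \<Rightarrow> real"
  assumes "finite A"
  shows "2 ^ card A * (sum f A)\<^sup>2 \<le> 4 * (\<Sum>J\<in>Pow A. (sum f (A - J))\<^sup>2)"
proof -
  have "(sum f A)\<^sup>2 \<le> 2 * (sum f (A - J))\<^sup>2 + 2 * (sum f J)\<^sup>2" if "J \<subseteq> A" for J
    using sum.subset_diff[OF that assms, of f] sum_squares_bound[of "sum f (A - J)" "sum f J"]
    by (simp add: power2_sum)
  then have "(\<Sum>J\<in>Pow A. (sum f A)\<^sup>2) \<le> (\<Sum>J\<in>Pow A. 2 * (sum f (A - J))\<^sup>2 + 2 * (sum f J)\<^sup>2)"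
    by (intro sum_mono) simp
  moreover have "(\<Sum>J\<in>Pow A. (sum f J)\<^sup>2) = (\<Sum>J\<in>Pow A. (sum f (A - J))\<^sup>2)"
    by (rule sum.reindex_bij_witness[of _ "\<lambda>J. A - J" "\<lambda>J. A - J"]) (auto simp: double_diff)
  ultimately show ?thesis
    using assms by (simp add: card_Pow sum.distrib flip: sum_distrib_left)
qed

lemma (in car_family) symbol_norm_le_of_fock_bound:
  fixes \<beta> :: "nat \<Rightarrow> complex"
  assumes v: "v \<noteq> (0::'a)" and M: "0 \<le> M"
    and bound: "\<And>u. fock_norm_square d (fermionic_sum d (\<lambda>k. cnj (\<beta> k)) (\<lambda>k h. \<beta> k *\<^sub>C C k h) u) \<le>
      M * (\<Sum>k<d. (cmod (\<beta> k))\<^sup>2) * fock_norm_square d u"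
  shows "(\<Sum>k<d. (cmod (\<beta> k))\<^sup>2) \<le> 4 * M"
proof -
  obtain \<Omega> where \<Omega>: "norm \<Omega> = 1" "\<And>k. k < d \<Longrightarrow> C k \<Omega> = 0" using vacuum_exists[OF v] by blast
  define W where "W = (\<Sum>k<d. (cmod (\<beta> k))\<^sup>2)"
  let ?Y = "fermionic_sum d (\<lambda>k. cnj (\<beta> k)) (\<lambda>k h. \<beta> k *\<^sub>C C k h) (fock \<Omega>)"
  have norm_1: "norm (fock \<Omega> J) = 1" if "J \<in> Pow {..<d}" for J
    using that \<Omega> finite_subset[of J "{..<d}"] by (subst norm_fock) auto
  have norm_Y: "norm (?Y J) = (\<Sum>k\<in>{..<d} - J. (cmod (\<beta> k))\<^sup>2)" if J: "J \<in> Pow {..<d}" for J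
  proof -
    have "(cnj (\<beta> k) * fermion_sign k J) *\<^sub>C (\<beta> k *\<^sub>C C k (fock \<Omega> (insert k J))) =
        complex_of_real ((cmod (\<beta> k))\<^sup>2) *\<^sub>C fock \<Omega> J" if "k \<in> {..<d} - J" for k
    proof -
      have "C k (fock \<Omega> (insert k J)) = fermion_sign k J *\<^sub>C fock \<Omega> J"
        using that J finite_subset[of J "{..<d}"] by (intro C_fock_insert \<Omega>) auto
      moreover have "cnj (\<beta> k) * fermion_sign k J * (\<beta> k * fermion_sign k J) = complex_of_real ((cmod (\<beta> k))\<^sup>2)"
        using complex_norm_square[of "\<beta> k"] fermion_sign_mult_self[of k J]
        by (metis mult.assoc mult.commute mult_1)
      ultimately show ?thesis by (simp add: scaleC_scaleC)
    qed
    then have "?Y J = complex_of_real (\<Sum>k\<in>{..<d} - J. (cmod (\<beta> k))\<^sup>2) *\<^sub>C fock \<Omega> J"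
      by (simp add: fermionic_sum_def scaleC_left.sum)
    then show ?thesis using norm_1[OF J] by (simp only: norm_scaleC norm_of_real) (simp add: sum_nonneg)
  qed
  have "2 ^ d * W\<^sup>2 \<le> 4 * fock_norm_square d ?Y"
    using sum_Pow_complement_ge[of "{..<d}" "\<lambda>k. (cmod (\<beta> k))\<^sup>2"]
    by (simp add: W_def fock_norm_square_def norm_Y)
  also have "\<dots> \<le> 4 * (M * W * 2 ^ d)"
    using bound[of "fock \<Omega>"] unfolding fock_norm_square_def[of d "fock \<Omega>"]
    by (simp add: W_def norm_1 card_Pow)
  finally have "W * W \<le> 4 * M * W" by (simp add: power2_eq_square)
  moreover have "0 \<le> W" unfolding W_def by (simp add: sum_nonneg)
  ultimately show ?thesis using M unfolding W_def[symmetric] by (cases "W = 0") simp_all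
qed

lemma (in car_family) compression_symbol_bounded:
  fixes R :: "'b::complex_inner \<Rightarrow> 'b" and \<beta> :: "nat \<Rightarrow> complex"
  assumes v: "v \<noteq> (0::'a)" and R: "bounded_clinear R" "similar_contraction R"
    and \<iota>: "\<And>h. norm (\<iota> h) \<le> K * norm h"
    and \<pi>: "bounded_clinear \<pi>" "\<And>z. norm (\<pi> z) \<le> norm z"
    and compression: "\<And>k h. \<pi> ((R ^^ k) (\<iota> h)) = \<beta> k *\<^sub>C C k h"
  obtains S where "\<And>d. (\<Sum>k<d. (cmod (\<beta> k))\<^sup>2) \<le> S"
proof -
  interpret \<pi>: bounded_clinear \<pi> by (rule \<pi>(1))
  obtain M where M: "0 \<le> M"
    and bound: "\<And>d c x. fock_norm_square d (fermionic_sum d c (\<lambda>k. R ^^ k) x) \<le>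
      M * (\<Sum>k<d. (cmod (c k))\<^sup>2) * fock_norm_square d x"
    using similar_contraction_fermionic_bound[OF R] by blast
  have "(\<Sum>k<d. (cmod (\<beta> k))\<^sup>2) \<le> 4 * (M * K\<^sup>2)" for d
  proof (rule symbol_norm_le_of_fock_bound[OF v])
    fix u :: "nat set \<Rightarrow> 'a"
    let ?c = "\<lambda>k. cnj (\<beta> k)"
    let ?T = "fermionic_sum d ?c (\<lambda>k. R ^^ k) (\<lambda>J. \<iota> (u J))"
    have "fermionic_sum d ?c (\<lambda>k h. \<beta> k *\<^sub>C C k h) u J = \<pi> (?T J)" for J
      by (simp add: \<pi>.fermionic_sum_image) (simp add: fermionic_sum_def compression)
    then have "fock_norm_square d (fermionic_sum d ?c (\<lambda>k h. \<beta> k *\<^sub>C C k h) u) \<le> 1\<^sup>2 * fock_norm_square d ?T"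
      by (intro fock_norm_square_le) (simp add: \<pi>(2))
    also have "\<dots> \<le> M * (\<Sum>k<d. (cmod (\<beta> k))\<^sup>2) * fock_norm_square d (\<lambda>J. \<iota> (u J))"
      using bound[where c = ?c] by simp
    also have "\<dots> \<le> M * (\<Sum>k<d. (cmod (\<beta> k))\<^sup>2) * (K\<^sup>2 * fock_norm_square d u)"
      using M by (intro mult_left_mono fock_norm_square_le \<iota> mult_nonneg_nonneg sum_nonneg) simp_all
    finally show "fock_norm_square d (fermionic_sum d ?c (\<lambda>k h. \<beta> k *\<^sub>C C k h) u) \<le>
        M * K\<^sup>2 * (\<Sum>k<d. (cmod (\<beta> k))\<^sup>2) * fock_norm_square d u"
      by (simp add: mult_ac)
  qed (simp add: M)
  then show ?thesis by (rule that)
qed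

section \<open>Weighted Hankel matrices\<close>

definition matrix_bounded :: "(nat \<Rightarrow> nat \<Rightarrow> 'a::real_normed_vector \<Rightarrow> 'b::real_normed_vector) \<Rightarrow> real \<Rightarrow> bool" where
  "matrix_bounded A B \<longleftrightarrow> (\<forall>L N x. (\<Sum>i<L. (norm (\<Sum>j<N. A i j (x j)))\<^sup>2) \<le> B * (\<Sum>j<N. (norm (x j))\<^sup>2))"

lemma matrix_boundedD:
  "matrix_bounded A B \<Longrightarrow> (\<Sum>i<L. (norm (\<Sum>j<N. A i j (x j)))\<^sup>2) \<le> B * (\<Sum>j<N. (norm (x j))\<^sup>2)"
  by (simp add: matrix_bounded_def)

definition (in creation_annihilation) weighted_hankel ::
    "(nat \<Rightarrow> complex) \<Rightarrow> (nat \<Rightarrow> complex) \<Rightarrow> nat \<Rightarrow> nat \<Rightarrow> 'a \<Rightarrow> 'a" where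
  "weighted_hankel w \<alpha> i j v = (w j * \<alpha> (i + j)) *\<^sub>C C (i + j) v"

lemma (in creation_annihilation) bounded_clinear_weighted_hankel:
  "bounded_clinear (weighted_hankel w \<alpha> i j)"
  unfolding weighted_hankel_def[abs_def]
  by (rule bounded_clinear_compose[OF bounded_clinear_scaleC bounded_clinear_C])

lemma L2_set_sum_le:
  "L2_set (\<lambda>i. \<Sum>b\<in>B. f b i) I \<le> (\<Sum>b\<in>B. L2_set (f b) I)"
proof (induction B rule: infinite_finite_induct)
  case (insert b B)
  have "L2_set (\<lambda>i. f b i + (\<Sum>b\<in>B. f b i)) I \<le> L2_set (f b) I + L2_set (\<lambda>i. \<Sum>b\<in>B. f b i) I"
    by (rule L2_set_triangle_ineq)
  then show ?case using insert by simp
qed (simp_all add: L2_set_def)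

lemma column_blocks_bound:
  fixes y :: "'i \<Rightarrow> 'j \<Rightarrow> 'a::real_normed_vector"
  assumes fin: "finite J" "finite B" and blocks: "\<beta> ` J \<subseteq> B"
    and nonneg: "\<And>b. 0 \<le> t b" "\<And>j. 0 \<le> a j"
    and bound: "\<And>b. b \<in> B \<Longrightarrow>
      (\<Sum>i\<in>I. (norm (\<Sum>j | j \<in> J \<and> \<beta> j = b. y i j))\<^sup>2) \<le> t b * (\<Sum>j | j \<in> J \<and> \<beta> j = b. a j)"
  shows "(\<Sum>i\<in>I. (norm (\<Sum>j\<in>J. y i j))\<^sup>2) \<le> (\<Sum>b\<in>B. t b) * (\<Sum>j\<in>J. a j)"
proof -
  define Y where "Y b i = (\<Sum>j | j \<in> J \<and> \<beta> j = b. y i j)" for b i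
  define X where "X b = (\<Sum>j | j \<in> J \<and> \<beta> j = b. a j)" for b
  have X: "0 \<le> X b" for b unfolding X_def by (intro sum_nonneg nonneg)
  have "L2_set (\<lambda>i. norm (\<Sum>j\<in>J. y i j)) I = L2_set (\<lambda>i. norm (\<Sum>b\<in>B. Y b i)) I"
    unfolding Y_def by (simp add: sum.group[OF fin blocks])
  also have "\<dots> \<le> L2_set (\<lambda>i. \<Sum>b\<in>B. norm (Y b i)) I"
    by (intro L2_set_mono norm_sum) simp
  also have "\<dots> \<le> (\<Sum>b\<in>B. L2_set (\<lambda>i. norm (Y b i)) I)"
    by (rule L2_set_sum_le)
  also have "\<dots> \<le> (\<Sum>b\<in>B. \<bar>sqrt (t b)\<bar> * \<bar>sqrt (X b)\<bar>)"
    using bound nonneg X unfolding X_def Y_def L2_set_def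
    by (intro sum_mono) (simp flip: real_sqrt_mult)
  also have "\<dots> \<le> L2_set (\<lambda>b. sqrt (t b)) B * L2_set (\<lambda>b. sqrt (X b)) B"
    by (rule L2_set_mult_ineq)
  also have "\<dots> = sqrt ((\<Sum>b\<in>B. t b) * (\<Sum>b\<in>B. X b))"
    using nonneg X by (simp add: L2_set_def real_sqrt_mult)
  also have "(\<Sum>b\<in>B. X b) = (\<Sum>j\<in>J. a j)"
    unfolding X_def by (rule sum.group[OF fin blocks])
  finally show ?thesis by (simp add: L2_set_def)
qed

context creation_annihilation
begin

lemma weighted_hankel_columns_bound:
  assumes J: "J \<subseteq> {p..<n}" and w: "\<And>j. j \<in> J \<Longrightarrow> cmod (w j) \<le> W"
  shows "(\<Sum>i<N. (norm (\<Sum>j\<in>J. weighted_hankel w \<alpha> i j (x j)))\<^sup>2) \<le>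
    (W\<^sup>2 * (\<Sum>k\<in>{p..<N + n}. (cmod (\<alpha> k))\<^sup>2)) * (\<Sum>j\<in>J. (norm (x j))\<^sup>2)"
proof -
  define c where "c k = (if p \<le> k then \<alpha> k else 0)" for k
  define z where "z j = (if j \<in> J then w j *\<^sub>C x j else 0)" for j
  have J': "J \<subseteq> {..<n}" using J by auto
  have "(\<Sum>j\<in>J. weighted_hankel w \<alpha> i j (x j)) = (\<Sum>j<n. c (i + j) *\<^sub>C C (i + j) (z j))" for i
    using J by (intro sum.mono_neutral_cong_left)
      (auto simp: c_def z_def weighted_hankel_def C.zero C.scaleC scaleC_scaleC mult.commute)
  then have "(\<Sum>i<N. (norm (\<Sum>j\<in>J. weighted_hankel w \<alpha> i j (x j)))\<^sup>2) \<le>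
      (\<Sum>k<N + n. (cmod (c k))\<^sup>2) * (\<Sum>j<n. (norm (z j))\<^sup>2)"
    by (simp only: Hankel_section_bound)
  also have "(\<Sum>k<N + n. (cmod (c k))\<^sup>2) = (\<Sum>k\<in>{p..<N + n}. (cmod (\<alpha> k))\<^sup>2)"
    by (rule sum.mono_neutral_cong_right) (auto simp: c_def)
  also have "(\<Sum>j<n. (norm (z j))\<^sup>2) = (\<Sum>j\<in>J. (cmod (w j))\<^sup>2 * (norm (x j))\<^sup>2)"
    using J' by (intro sum.mono_neutral_cong_right) (auto simp: z_def norm_scaleC power_mult_distrib)
  also have "(\<Sum>k\<in>{p..<N + n}. (cmod (\<alpha> k))\<^sup>2) * (\<Sum>j\<in>J. (cmod (w j))\<^sup>2 * (norm (x j))\<^sup>2) \<le>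
      (\<Sum>k\<in>{p..<N + n}. (cmod (\<alpha> k))\<^sup>2) * (\<Sum>j\<in>J. W\<^sup>2 * (norm (x j))\<^sup>2)"
    by (intro mult_left_mono sum_mono mult_right_mono power_mono w sum_nonneg) simp_all
  finally show ?thesis by (simp add: mult_ac flip: sum_distrib_left)
qed

lemma matrix_bounded_hankel:
  assumes "summable (\<lambda>n. (cmod (\<alpha> n))\<^sup>2)"
  shows "matrix_bounded (weighted_hankel (\<lambda>_. 1) \<alpha>) (\<Sum>n. (cmod (\<alpha> n))\<^sup>2)"
  unfolding matrix_bounded_def
proof (intro allI)
  fix L N and x :: "nat \<Rightarrow> 'a"
  have "(\<Sum>i<L. (norm (\<Sum>j<N. weighted_hankel (\<lambda>_. 1) \<alpha> i j (x j)))\<^sup>2) \<le>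
      (1\<^sup>2 * (\<Sum>k\<in>{0..<L + N}. (cmod (\<alpha> k))\<^sup>2)) * (\<Sum>j<N. (norm (x j))\<^sup>2)"
    by (rule weighted_hankel_columns_bound) auto
  also have "\<dots> \<le> (\<Sum>n. (cmod (\<alpha> n))\<^sup>2) * (\<Sum>j<N. (norm (x j))\<^sup>2)"
    using sum_le_suminf[OF assms, of "{0..<L + N}"] by (intro mult_right_mono sum_nonneg) simp_all
  finally show "(\<Sum>i<L. (norm (\<Sum>j<N. weighted_hankel (\<lambda>_. 1) \<alpha> i j (x j)))\<^sup>2) \<le>
      (\<Sum>n. (cmod (\<alpha> n))\<^sup>2) * (\<Sum>j<N. (norm (x j))\<^sup>2)" .
qed

end

lemma sum_powers_of_4_le:
  assumes "0 < q"
  shows "(\<Sum>b | b < n \<and> 2 ^ b \<le> q. 4 ^ Suc b) \<le> 8 * (real q)\<^sup>2"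
proof -
  have "b \<le> floor_log q" if "2 ^ b \<le> q" for b
    using floor_log_le_iff[OF that] by simp
  then have "(\<Sum>b | b < n \<and> 2 ^ b \<le> q. 4 ^ Suc b) \<le> (\<Sum>b\<le>floor_log q. (4::real) ^ Suc b)"
    by (intro sum_mono2) auto
  also have "(\<Sum>b\<le>m. (4::real) ^ Suc b) \<le> 8 * 4 ^ m" for m
  proof (induction m)
    case (Suc m)
    have "(\<Sum>b\<le>Suc m. (4::real) ^ Suc b) = (\<Sum>b\<le>m. 4 ^ Suc b) + 16 * 4 ^ m" by simp
    moreover have "0 \<le> (4::real) ^ m" by simp
    ultimately show ?case using Suc unfolding power_Suc[of _ m] by linarith
  qed simp
  also have "(4::real) ^ floor_log q = (real (2 ^ floor_log q))\<^sup>2"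
    by (simp add: power2_eq_square flip: power_mult_distrib)
  also have "\<dots> \<le> (real q)\<^sup>2"
    using floor_log_exp2_le[OF assms] by (intro power_mono) (simp_all del: of_nat_power)
  finally show ?thesis by simp
qed

lemma sum_dyadic_tails_le:
  fixes a :: "nat \<Rightarrow> real"
  assumes "\<And>k. 0 \<le> a k"
  shows "(\<Sum>b<n. (2 ^ Suc b)\<^sup>2 * (\<Sum>k\<in>{2 ^ b - 1..<m}. a k)) \<le> 8 * (\<Sum>k<m. (real (Suc k))\<^sup>2 * a k)"
proof -
  have "(\<Sum>b<n. (2 ^ Suc b)\<^sup>2 * (\<Sum>k\<in>{2 ^ b - 1..<m}. a k)) =
      (\<Sum>b<n. \<Sum>k | k < m \<and> 2 ^ b \<le> Suc k. a k * 4 ^ Suc b)"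
    unfolding sum_distrib_left
    by (intro sum.cong) (auto simp: le_diff_conv power2_eq_square mult_ac simp flip: power_mult_distrib)
  also have "\<dots> = (\<Sum>k<m. \<Sum>b | b < n \<and> 2 ^ b \<le> Suc k. a k * 4 ^ Suc b)"
    using sum.swap_restrict[of "{..<n}" "{..<m}" "\<lambda>b k. a k * 4 ^ Suc b" "\<lambda>b k. 2 ^ b \<le> Suc k"] by simp
  also have "\<dots> \<le> (\<Sum>k<m. a k * (8 * (real (Suc k))\<^sup>2))"
    unfolding sum_distrib_left[symmetric] by (intro sum_mono mult_left_mono sum_powers_of_4_le assms) simp
  finally show ?thesis by (simp add: sum_distrib_left mult_ac del: of_nat_Suc)
qed

text \<open>On the dyadic block \<open>2 ^ b \<le> j + 1 < 2 ^ (b + 1)\<close> of columns the weight is essentially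
  constant, and only the coefficients with \<open>k + 1 \<ge> 2 ^ b\<close> occur.\<close>

theorem (in creation_annihilation) matrix_bounded_weighted_hankel:
  assumes S: "\<And>d. (\<Sum>k<d. (real (Suc k) * cmod (\<alpha> k))\<^sup>2) \<le> S"
  shows "matrix_bounded (weighted_hankel (\<lambda>j. of_nat (Suc j)) \<alpha>) (8 * S)"
  unfolding matrix_bounded_def
proof (intro allI)
  fix N n and x :: "nat \<Rightarrow> 'a"
  define block where "block j = floor_log (Suc j)" for j
  define t where "t b = (2 ^ Suc b)\<^sup>2 * (\<Sum>k\<in>{2 ^ b - 1..<N + n}. (cmod (\<alpha> k))\<^sup>2)" for b
  have lower: "2 ^ block j \<le> Suc j" and upper: "Suc j \<le> 2 ^ Suc (block j)" for j
    using floor_log_exp2_le[of "Suc j"] floor_log_exp2_gt[of "Suc j"] by (auto simp: block_def)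
  have "(\<Sum>i<N. (norm (\<Sum>j<n. weighted_hankel (\<lambda>j. of_nat (Suc j)) \<alpha> i j (x j)))\<^sup>2) \<le>
      (\<Sum>b<n. t b) * (\<Sum>j<n. (norm (x j))\<^sup>2)"
  proof (rule column_blocks_bound[where \<beta> = block])
    show "block ` {..<n} \<subseteq> {..<n}"
    proof clarsimp
      fix j assume "j < n"
      then have "(2::nat) ^ block j < 2 ^ n" using lower[of j] less_exp[of n] by linarith
      then show "block j < n" by simp
    qed
    show "(\<Sum>i<N. (norm (\<Sum>j | j \<in> {..<n} \<and> block j = b. weighted_hankel (\<lambda>j. of_nat (Suc j)) \<alpha> i j (x j)))\<^sup>2) \<le>
        t b * (\<Sum>j | j \<in> {..<n} \<and> block j = b. (norm (x j))\<^sup>2)" for b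
      unfolding t_def
    proof (rule weighted_hankel_columns_bound)
      show "{j. j \<in> {..<n} \<and> block j = b} \<subseteq> {2 ^ b - 1..<n}"
        using lower by (force simp: le_diff_conv)
      show "cmod (of_nat (Suc j)) \<le> 2 ^ Suc b" if "j \<in> {j. j \<in> {..<n} \<and> block j = b}" for j
      proof -
        have "real (Suc j) \<le> real (2 ^ Suc b)" using upper[of j] that by (simp only: of_nat_le_iff) simp
        then show ?thesis by (simp only: norm_of_nat of_nat_power of_nat_numeral)
      qed
    qed
  qed (simp_all add: t_def sum_nonneg)
  also have "\<dots> \<le> 8 * (\<Sum>k<N + n. (real (Suc k))\<^sup>2 * (cmod (\<alpha> k))\<^sup>2) * (\<Sum>j<n. (norm (x j))\<^sup>2)"
    unfolding t_def by (intro mult_right_mono sum_dyadic_tails_le sum_nonneg) simp_all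
  also have "\<dots> \<le> 8 * S * (\<Sum>j<n. (norm (x j))\<^sup>2)"
    using S[of "N + n"] by (intro mult_right_mono sum_nonneg) (simp_all add: power_mult_distrib del: of_nat_Suc)
  finally show "(\<Sum>i<N. (norm (\<Sum>j<n. weighted_hankel (\<lambda>j. of_nat (Suc j)) \<alpha> i j (x j)))\<^sup>2) \<le>
      8 * S * (\<Sum>j<n. (norm (x j))\<^sup>2)" .
qed

section \<open>Block operators on square-summable sequences\<close>

lemma summable_square_comparison:
  fixes f :: "nat \<Rightarrow> 'a::{real_normed_vector, complete_space}"
  assumes f: "\<And>m n. (norm (sum f {m..<n}))\<^sup>2 \<le> B * sum b {m..<n}"
    and b: "summable b" "\<And>n. 0 \<le> b n" and B: "0 \<le> B"
  shows "summable f"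
proof -
  have "Cauchy (\<lambda>n. \<Sum>i<n. f i)"
  proof (rule CauchyI')
    fix \<epsilon> :: real assume \<epsilon>: "0 < \<epsilon>"
    then have "0 < \<epsilon>\<^sup>2 / (B + 1)" using B by simp
    then obtain M where M: "\<And>m n. M \<le> m \<Longrightarrow> norm (sum b {m..<n}) < \<epsilon>\<^sup>2 / (B + 1)"
      using b(1) unfolding summable_Cauchy by meson
    have "dist (\<Sum>i<m. f i) (\<Sum>i<n. f i) < \<epsilon>" if "M \<le> m" "m < n" for m n
    proof -
      have "(\<Sum>i<n. f i) - (\<Sum>i<m. f i) = sum f {m..<n}"
        using that sum_diff_nat_ivl[of 0 m n f] by (simp add: atLeast0LessThan)
      then have "(dist (\<Sum>i<m. f i) (\<Sum>i<n. f i))\<^sup>2 \<le> B * sum b {m..<n}"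
        using f[of m n] by (subst dist_commute) (simp add: dist_norm)
      also have "\<dots> \<le> (B + 1) * sum b {m..<n}"
        using b(2) by (intro mult_right_mono sum_nonneg) simp_all
      also have "\<dots> < \<epsilon>\<^sup>2"
        using M[OF that(1), of n] B b(2) by (simp add: sum_nonneg pos_less_divide_eq mult.commute)
      finally show ?thesis using \<epsilon> by (simp add: power_less_imp_less_base less_imp_le)
    qed
    then show "\<exists>M. \<forall>m\<ge>M. \<forall>n>m. dist (\<Sum>i<m. f i) (\<Sum>i<n. f i) < \<epsilon>" by blast
  qed
  then show ?thesis
    using Cauchy_convergent by (auto simp: summable_def sums_def convergent_def)
qed

definition block_op ::
    "(nat \<Rightarrow> nat \<Rightarrow> 'a::complex_inner \<Rightarrow> 'b::complex_inner) \<Rightarrow> (nat, 'a) ell2 \<Rightarrow> (nat, 'b) ell2" where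
  "block_op A x = Abs_ell2 (\<lambda>i. \<Sum>j. A i j (coord x j))"

locale bounded_matrix =
  fixes A :: "nat \<Rightarrow> nat \<Rightarrow> 'a::complex_inner \<Rightarrow> 'b::{complex_inner, complete_space}" and B :: real
  assumes entry: "bounded_clinear (A i j)" and bounded: "matrix_bounded A B" and nonneg: "0 \<le> B"
begin

sublocale entry: bounded_clinear "A i j" for i j by (rule entry)

lemma row_summable: "summable (\<lambda>j. A i j (coord x j))"
proof (rule summable_square_comparison[OF _ summable_coord[of x] _ nonneg])
  fix m n
  define h where "h j = (if m \<le> j then coord x j else 0)" for j
  have "(\<Sum>j\<in>{m..<n}. A i j (coord x j)) = (\<Sum>j<n. A i j (h j))"
    by (rule sum.mono_neutral_cong_left) (auto simp: h_def entry.zero)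
  then have "(norm (\<Sum>j\<in>{m..<n}. A i j (coord x j)))\<^sup>2 \<le> (\<Sum>i<Suc i. (norm (\<Sum>j<n. A i j (h j)))\<^sup>2)"
    by (simp add: sum_nonneg)
  also have "\<dots> \<le> B * (\<Sum>j<n. (norm (h j))\<^sup>2)"
    by (rule matrix_boundedD[OF bounded])
  also have "(\<Sum>j<n. (norm (h j))\<^sup>2) = (\<Sum>j\<in>{m..<n}. (norm (coord x j))\<^sup>2)"
    by (rule sum.mono_neutral_cong_right) (auto simp: h_def)
  finally show "(norm (\<Sum>j\<in>{m..<n}. A i j (coord x j)))\<^sup>2 \<le> B * (\<Sum>j\<in>{m..<n}. (norm (coord x j))\<^sup>2)" .
qed simp

lemma rows_bound:
  assumes "finite F"
  shows "(\<Sum>i\<in>F. (norm (\<Sum>j. A i j (coord x j)))\<^sup>2) \<le> B * (norm x)\<^sup>2"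
proof (rule sum_nat_norm_square_le[OF _ assms], rule LIMSEQ_le_const2)
  fix L
  show "(\<lambda>N. \<Sum>i<L. (norm (\<Sum>j<N. A i j (coord x j)))\<^sup>2) \<longlonglongrightarrow> (\<Sum>i<L. (norm (\<Sum>j. A i j (coord x j)))\<^sup>2)"
    by (intro tendsto_sum tendsto_power tendsto_norm summable_LIMSEQ row_summable)
  have "(\<Sum>i<L. (norm (\<Sum>j<N. A i j (coord x j)))\<^sup>2) \<le> B * (\<Sum>j<N. (norm (coord x j))\<^sup>2)" for N
    by (rule matrix_boundedD[OF bounded])
  also have "B * (\<Sum>j<N. (norm (coord x j))\<^sup>2) \<le> B * (norm x)\<^sup>2" for N
    by (intro mult_left_mono sum_coord_le_norm nonneg) simp
  finally show "\<exists>M. \<forall>N\<ge>M. (\<Sum>i<L. (norm (\<Sum>j<N. A i j (coord x j)))\<^sup>2) \<le> B * (norm x)\<^sup>2"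
    by blast
qed

lemma coord_block_op: "coord (block_op A x) i = (\<Sum>j. A i j (coord x j))"
  by (simp add: block_op_def coord_Abs_ell2[OF square_summable_bounded[OF rows_bound]])

lemma bounded_clinear_block_op: "bounded_clinear (block_op A)"
proof (rule bounded_clinear_intro)
  show "block_op A (x + y) = block_op A x + block_op A y" for x y
    by (rule ell2_eqI) (simp add: coord_block_op entry.add suminf_add row_summable)
  show "block_op A (c *\<^sub>C x) = c *\<^sub>C block_op A x" for c x
    by (rule ell2_eqI)
      (simp add: coord_block_op entry.scaleC bounded_linear.suminf[OF bounded_linear_scaleC_right row_summable])
  show "norm (block_op A x) \<le> sqrt B * norm x" for x
  proof (rule power2_le_imp_le)
    have "(norm (block_op A x))\<^sup>2 \<le> B * (norm x)\<^sup>2"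
      by (rule norm_ell2_le) (simp add: coord_block_op rows_bound)
    then show "(norm (block_op A x))\<^sup>2 \<le> (sqrt B * norm x)\<^sup>2"
      by (simp add: power_mult_distrib nonneg)
  qed (simp add: nonneg)
qed

end

section \<open>Foguel operators\<close>

lift_definition forward_shift :: "(nat, 'a::complex_inner) ell2 \<Rightarrow> (nat, 'a) ell2" is fshift
  subgoal for f
    by (rule square_summable_reindex[of f "\<lambda>n. n - 1" "{0<..}"]) (auto simp: fshift_def inj_on_def)
  done

lift_definition backward_shift :: "(nat, 'a::complex_inner) ell2 \<Rightarrow> (nat, 'a) ell2" is bshift
  subgoal for f
    by (rule square_summable_reindex[of f Suc UNIV]) (simp_all add: bshift_def)
  done

lemma coord_forward_shift [simp]: "coord (forward_shift x) n = (if n = 0 then 0 else coord x (n - 1))"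
  by (simp add: forward_shift.rep_eq fshift_def)

lemma coord_backward_shift [simp]: "coord (backward_shift x) n = coord x (Suc n)"
  by (simp add: backward_shift.rep_eq bshift_def)

lemma norm_forward_shift_le: "norm (forward_shift x) \<le> norm x"
  by (rule norm_ell2_reindex_le[of "\<lambda>n. n - 1" "{0<..}"]) (auto simp: inj_on_def)

lemma norm_backward_shift_le: "norm (backward_shift x) \<le> norm x"
  by (rule norm_ell2_reindex_le[of Suc UNIV]) simp_all

lemma bounded_clinear_forward_shift: "bounded_clinear forward_shift"
  by (rule bounded_clinear_intro[where K = 1]; (rule ell2_eqI)?) (simp_all add: norm_forward_shift_le)

lemma bounded_clinear_backward_shift: "bounded_clinear backward_shift"
  by (rule bounded_clinear_intro[where K = 1]; (rule ell2_eqI)?) (simp_all add: norm_backward_shift_le)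

lemma backward_forward_shift [simp]: "backward_shift (forward_shift x) = x"
  by (rule ell2_eqI) simp

lemma coord_backward_shift_funpow: "coord ((backward_shift ^^ n) x) i = coord x (i + n)"
  by (induction n arbitrary: i) simp_all

type_synonym 'a ell2_pair = "(nat, 'a) ell2 \<times> (nat, 'a) ell2"

definition foguel ::
    "((nat, 'a::complex_inner) ell2 \<Rightarrow> (nat, 'a) ell2) \<Rightarrow> 'a ell2_pair \<Rightarrow> 'a ell2_pair" where
  "foguel \<Gamma> z = (backward_shift (fst z) + \<Gamma> (snd z), forward_shift (snd z))"

lemma bounded_clinear_foguel:
  assumes "bounded_clinear \<Gamma>"
  shows "bounded_clinear (foguel \<Gamma>)"
proof -
  interpret \<Gamma>: bounded_clinear \<Gamma> by fact
  interpret S: bounded_clinear forward_shift by (rule bounded_clinear_forward_shift)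
  interpret S': bounded_clinear backward_shift by (rule bounded_clinear_backward_shift)
  have "bounded_linear (foguel \<Gamma>)"
    unfolding foguel_def[abs_def]
    by (intro bounded_linear_Pair bounded_linear_add
        bounded_linear_compose[OF S'.bounded_linear_axioms bounded_linear_fst]
        bounded_linear_compose[OF \<Gamma>.bounded_linear_axioms bounded_linear_snd]
        bounded_linear_compose[OF S.bounded_linear_axioms bounded_linear_snd])
  then show ?thesis
    by (rule bounded_clinear.intro)
      (simp add: bounded_clinear_axioms_def foguel_def prod_eq_iff \<Gamma>.scaleC S.scaleC S'.scaleC scaleC_add_right)
qed

lemma norm_foguel_zero_le: "norm (foguel (\<lambda>_. 0) z) \<le> norm z"
  unfolding norm_prod_def foguel_def
  by (intro real_sqrt_le_mono add_mono power_mono) (simp_all add: norm_forward_shift_le norm_backward_shift_le)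

lemma foguel_funpow:
  assumes "bounded_clinear \<Gamma>" and hankel: "\<And>y. \<Gamma> (forward_shift y) = backward_shift (\<Gamma> y)"
  shows "(foguel \<Gamma> ^^ Suc n) z = ((backward_shift ^^ Suc n) (fst z) +
    of_nat (Suc n) *\<^sub>C (backward_shift ^^ n) (\<Gamma> (snd z)), (forward_shift ^^ Suc n) (snd z))"
proof (induction n)
  case 0
  show ?case by (simp add: foguel_def)
next
  case (Suc n)
  interpret S': bounded_clinear backward_shift by (rule bounded_clinear_backward_shift)
  have "\<Gamma> ((forward_shift ^^ m) y) = (backward_shift ^^ m) (\<Gamma> y)" for m y
    by (induction m) (simp_all add: hankel)
  moreover have "of_nat (Suc (Suc n)) *\<^sub>C v = of_nat (Suc n) *\<^sub>C v + v" for v :: "(nat, 'a) ell2"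
    by (simp only: of_nat_Suc[of "Suc n"] scaleC_add_left scaleC_one add.commute)
  ultimately show ?case
    unfolding funpow.simps(2)[of "Suc n"] comp_apply Suc.IH
    by (simp add: foguel_def S'.add S'.scaleC hankel add.assoc del: of_nat_Suc)
qed

definition shear :: "('b \<Rightarrow> 'a::plus) \<Rightarrow> 'a \<times> 'b \<Rightarrow> 'a \<times> 'b" where
  "shear X z = (fst z + X (snd z), snd z)"

lemma bounded_clinear_shear:
  fixes X :: "'b::complex_inner \<Rightarrow> 'a::complex_inner"
  assumes "bounded_clinear X"
  shows "bounded_clinear (shear X)"
proof -
  interpret X: bounded_clinear X by fact
  have "bounded_linear (shear X)"
    unfolding shear_def[abs_def]
    by (intro bounded_linear_Pair bounded_linear_add bounded_linear_fst bounded_linear_snd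
        bounded_linear_compose[OF X.bounded_linear_axioms bounded_linear_snd])
  then show ?thesis
    by (rule bounded_clinear.intro)
      (simp add: bounded_clinear_axioms_def shear_def prod_eq_iff X.scaleC scaleC_add_right)
qed

lemma similar_contraction_foguel:
  assumes X: "bounded_clinear X" and commutator: "\<And>y. X (forward_shift y) = backward_shift (X y) + \<Gamma> y"
  shows "similar_contraction (foguel \<Gamma>)"
  unfolding similar_contraction_def
proof (rule exI[of _ "shear X"], rule exI[of _ "shear (\<lambda>y. - X y)"], intro conjI allI)
  interpret S': bounded_clinear backward_shift by (rule bounded_clinear_backward_shift)
  have "bounded_clinear (\<lambda>y. (-1) *\<^sub>C X y)" by (rule bounded_clinear_compose[OF bounded_clinear_scaleC X])
  then have "bounded_clinear (\<lambda>y. - X y)" by (simp add: scaleC_left.minus)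
  then show "bounded_clinear (shear (\<lambda>y. - X y))" by (rule bounded_clinear_shear)
  show "bounded_clinear (shear X)" by (rule bounded_clinear_shear[OF X])
  show "shear X (shear (\<lambda>y. - X y) z) = z" "shear (\<lambda>y. - X y) (shear X z) = z" for z
    by (simp_all add: shear_def)
  have "shear (\<lambda>y. - X y) (foguel \<Gamma> (shear X z)) = foguel (\<lambda>_. 0) z" for z
    by (simp add: shear_def foguel_def commutator S'.add)
  then show "norm (shear (\<lambda>y. - X y) (foguel \<Gamma> (shear X z))) \<le> norm z" for z
    by (simp add: norm_foguel_zero_le)
qed

section \<open>Foguel--Hankel operators of fermionic type\<close>

locale car_hankel = car_family C D
  for C D :: "nat \<Rightarrow> 'a::{complex_inner, complete_space} \<Rightarrow> 'a" +
  fixes \<alpha> :: "nat \<Rightarrow> complex"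
  assumes summable_symbol: "summable (\<lambda>n. (cmod (\<alpha> n))\<^sup>2)"
begin

sublocale hankel: bounded_matrix "weighted_hankel (\<lambda>_. 1) \<alpha>" "\<Sum>n. (cmod (\<alpha> n))\<^sup>2"
  by (intro bounded_matrix.intro bounded_clinear_weighted_hankel matrix_bounded_hankel summable_symbol
      suminf_nonneg zero_le_power2)

definition hankel :: "(nat, 'a) ell2 \<Rightarrow> (nat, 'a) ell2" where
  "hankel = block_op (weighted_hankel (\<lambda>_. 1) \<alpha>)"

lemma coord_hankel: "coord (hankel x) = Hankel_op \<alpha> C (coord x)"
  by (simp add: fun_eq_iff hankel_def hankel.coord_block_op Hankel_op_def weighted_hankel_def)

lemma bounded_clinear_hankel: "bounded_clinear hankel"
  unfolding hankel_def by (rule hankel.bounded_clinear_block_op)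

lemma coord_hankel_single: "coord (hankel (single n h)) i = \<alpha> (i + n) *\<^sub>C C (i + n) h"
proof -
  have "(\<lambda>j. \<alpha> (i + j) *\<^sub>C C (i + j) (coord (single n h) j)) =
      (\<lambda>j. if j = n then \<alpha> (i + n) *\<^sub>C C (i + n) h else 0)"
    by (auto simp: C.zero)
  then show ?thesis
    using sums_unique[OF sums_single[of n "\<lambda>_. \<alpha> (i + n) *\<^sub>C C (i + n) h"]]
    by (simp add: coord_hankel Hankel_op_def)
qed

lemma hankel_forward_shift: "hankel (forward_shift y) = backward_shift (hankel y)"
proof (rule ell2_eqI)
  fix i
  let ?f = "\<lambda>j. weighted_hankel (\<lambda>_. 1) \<alpha> i j (coord (forward_shift y) j)"
  have "?f 0 = 0" by (simp add: hankel.entry.zero)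
  moreover have "(\<lambda>j. ?f (Suc j)) = (\<lambda>j. weighted_hankel (\<lambda>_. 1) \<alpha> (Suc i) j (coord y j))"
    by (simp add: weighted_hankel_def)
  ultimately show "coord (hankel (forward_shift y)) i = coord (backward_shift (hankel y)) i"
    using suminf_split_head[OF hankel.row_summable[of i "forward_shift y"]]
    by (simp add: hankel_def hankel.coord_block_op)
qed

abbreviation derived_hankel :: "nat \<Rightarrow> nat \<Rightarrow> 'a \<Rightarrow> 'a" where
  "derived_hankel \<equiv> weighted_hankel (\<lambda>j. of_nat (Suc j)) \<alpha>"

lemma derived_hankel_commutator:
  assumes "0 \<le> B" "matrix_bounded derived_hankel B"
  defines "W \<equiv> block_op derived_hankel"
  shows "W y = backward_shift (W (backward_shift y)) + hankel y"
proof (rule ell2_eqI)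
  interpret derived: bounded_matrix derived_hankel B
    using assms(1,2) by (intro bounded_matrix.intro bounded_clinear_weighted_hankel)
  fix i
  let ?w = "\<lambda>j. derived_hankel i j (coord y j)" and ?h = "\<lambda>j. weighted_hankel (\<lambda>_. 1) \<alpha> i j (coord y j)"
  have "summable (\<lambda>j. ?w j - ?h j)"
    by (intro summable_diff derived.row_summable hankel.row_summable)
  moreover have "?w 0 - ?h 0 = 0" by (simp add: weighted_hankel_def)
  moreover have "(\<lambda>j. ?w (Suc j) - ?h (Suc j)) = (\<lambda>j. derived_hankel (Suc i) j (coord (backward_shift y) j))"
    by (simp add: weighted_hankel_def flip: scaleC_left.diff) (simp add: algebra_simps)
  ultimately have "(\<Sum>j. derived_hankel (Suc i) j (coord (backward_shift y) j)) = (\<Sum>j. ?w j - ?h j)"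
    using suminf_split_head[of "\<lambda>j. ?w j - ?h j"] by simp
  also have "\<dots> = suminf ?w - suminf ?h"
    by (intro suminf_diff[symmetric] derived.row_summable hankel.row_summable)
  finally show "coord (W y) i = coord (backward_shift (W (backward_shift y)) + hankel y) i"
    by (simp add: W_def derived.coord_block_op hankel_def hankel.coord_block_op del: of_nat_Suc)
qed

theorem similar_contraction_if_derived_bounded:
  assumes "0 \<le> B" "matrix_bounded derived_hankel B"
  shows "similar_contraction (foguel hankel)"
proof (rule similar_contraction_foguel)
  interpret derived: bounded_matrix derived_hankel B
    using assms by (intro bounded_matrix.intro bounded_clinear_weighted_hankel)
  let ?X = "\<lambda>y. block_op derived_hankel (backward_shift y)"
  show "bounded_clinear ?X"
    by (rule bounded_clinear_compose[OF derived.bounded_clinear_block_op bounded_clinear_backward_shift])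
  show "?X (forward_shift y) = backward_shift (?X y) + hankel y" for y
    using derived_hankel_commutator[OF assms, of y] by simp
qed

lemma coord_fst_foguel_funpow:
  "coord (fst ((foguel hankel ^^ Suc n) (0, single 0 h))) i = derived_hankel i n h"
proof -
  interpret S': bounded_clinear "backward_shift ^^ m" for m
    by (rule bounded_clinear_funpow[OF bounded_clinear_backward_shift])
  show ?thesis
    unfolding foguel_funpow[OF bounded_clinear_hankel hankel_forward_shift]
    by (simp add: coord_backward_shift_funpow coord_hankel_single weighted_hankel_def scaleC_scaleC S'.zero
        del: of_nat_Suc funpow.simps)
qed

theorem derived_symbol_bounded:
  assumes v: "v \<noteq> (0::'a)" and sim: "similar_contraction (foguel hankel)"
  obtains S where "\<And>d. (\<Sum>k<d. (real (Suc k) * cmod (\<alpha> k))\<^sup>2) \<le> S"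
proof -
  define \<iota> where "\<iota> h = foguel hankel (0, single 0 h)" for h
  define \<pi> where "\<pi> z = coord (fst z) 0" for z :: "'a ell2_pair"
  have R: "bounded_clinear (foguel hankel)" by (rule bounded_clinear_foguel[OF bounded_clinear_hankel])
  interpret R: bounded_clinear "foguel hankel" by (rule R)
  obtain K where K: "\<And>z. norm (foguel hankel z) \<le> norm z * K" using R.bounded by blast
  have \<iota>: "norm (\<iota> h) \<le> K * norm h" for h
    using K[of "(0, single 0 h)"] by (simp add: \<iota>_def norm_Pair norm_single mult.commute)
  have \<pi>_le: "norm (\<pi> z) \<le> norm z" for z
    unfolding \<pi>_def using norm_coord_le norm_fst_le[of "fst z" "snd z"] by (rule order_trans[OF _ order_trans]) simp
  then have \<pi>: "bounded_clinear \<pi>"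
    by (intro bounded_clinear_intro[where K = 1]) (simp_all add: \<pi>_def)
  have "\<pi> ((foguel hankel ^^ k) (\<iota> h)) = (of_nat (Suc k) * \<alpha> k) *\<^sub>C C k h" for k h
    using coord_fst_foguel_funpow[of k h 0]
    by (simp add: \<pi>_def \<iota>_def weighted_hankel_def funpow_swap1)
  from compression_symbol_bounded[OF v R sim \<iota> \<pi> \<pi>_le this]
  obtain S where "\<And>d. (\<Sum>k<d. (cmod (of_nat (Suc k) * \<alpha> k))\<^sup>2) \<le> S" by blast
  then show ?thesis by (intro that[of S]) (simp add: norm_mult del: of_nat_Suc)
qed

theorem similar_contraction_foguel_hankel_iff:
  assumes "v \<noteq> (0::'a)"
  shows "similar_contraction (foguel hankel) \<longleftrightarrow> (\<exists>B\<ge>0. matrix_bounded derived_hankel B)"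
proof
  assume "similar_contraction (foguel hankel)"
  then obtain S where S: "\<And>d. (\<Sum>k<d. (real (Suc k) * cmod (\<alpha> k))\<^sup>2) \<le> S"
    using derived_symbol_bounded[OF assms] by blast
  have "matrix_bounded derived_hankel (8 * S)" by (rule matrix_bounded_weighted_hankel[OF S])
  moreover have "0 \<le> 8 * S" using S[of 0] by simp
  ultimately show "\<exists>B\<ge>0. matrix_bounded derived_hankel B" by blast
qed (use similar_contraction_if_derived_bounded in blast)

end

section \<open>Operators on pairs of sequences\<close>

definition l2sum_of :: "'a::complex_inner ell2_pair \<Rightarrow> 'a l2sum" where
  "l2sum_of z = (coord (fst z), coord (snd z))"

lemma inj_l2sum_of: "inj l2sum_of"
  by (rule injI) (simp add: l2sum_of_def coord_inject prod_eq_iff)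

lemma l2_eq_range_coord: "l2 = range coord"
proof -
  have "x \<in> l2 \<longleftrightarrow> square_summable x" for x :: "nat \<Rightarrow> 'a"
    by (simp add: l2_def square_summable_def summable_on_UNIV_nonneg_real_iff)
  then show ?thesis
    using type_definition.Rep_range[OF type_definition_ell2] by blast
qed

lemma K2_eq_range_l2sum_of: "K2 = range l2sum_of"
  unfolding K2_def l2_eq_range_coord image_paired_Times[symmetric] l2sum_of_def[abs_def]
  by (simp add: case_prod_unfold)

lemma l2sum_of_in_K2 [simp]: "l2sum_of z \<in> K2"
  by (simp add: K2_eq_range_l2sum_of)

lemma l2norm_coord: "l2norm (coord x) = norm x"
  unfolding l2norm_def norm_ell2_def using square_summable_coord[of x] unfolding square_summable_def
  by (simp add: sums_unique[OF has_sum_imp_sums[OF has_sum_infsum]])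

lemma Knorm_l2sum_of: "Knorm (l2sum_of z) = norm z"
  by (simp add: Knorm_def l2sum_of_def l2norm_coord norm_prod_def)

lemma Kadd_l2sum_of: "Kadd (l2sum_of z) (l2sum_of w) = l2sum_of (z + w)"
  by (simp add: Kadd_def l2sum_of_def fun_eq_iff)

lemma Kdiff_l2sum_of: "Kdiff (l2sum_of z) (l2sum_of w) = l2sum_of (z - w)"
  by (simp add: Kdiff_def l2sum_of_def fun_eq_iff minus_ell2.rep_eq)

lemma Kscale_l2sum_of: "Kscale c (l2sum_of z) = l2sum_of (c *\<^sub>C z)"
  by (simp add: Kscale_def l2sum_of_def fun_eq_iff)

lemma Ksum_l2sum_of: "Ksum (\<lambda>n. l2sum_of (z n)) I = l2sum_of (\<Sum>n\<in>I. z n)"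
  by (simp add: Ksum_def l2sum_of_def fun_eq_iff fst_sum snd_sum coord_sum)

lemma Hsub_eq_range: "Hsub = range (\<lambda>h. l2sum_of (0, single 0 h))"
  by (auto simp: Hsub_def l2sum_of_def fun_eq_iff)

definition represents ::
    "('a::complex_inner ell2_pair \<Rightarrow> 'a ell2_pair) \<Rightarrow> ('a l2sum \<Rightarrow> 'a l2sum) \<Rightarrow> bool" where
  "represents A R \<longleftrightarrow> (\<forall>z. R (l2sum_of z) = l2sum_of (A z))"

lemma representsD: "represents A R \<Longrightarrow> R (l2sum_of z) = l2sum_of (A z)"
  unfolding represents_def by blast

lemma represents_funpow:
  assumes "represents A R"
  shows "(R ^^ n) (l2sum_of z) = l2sum_of ((A ^^ n) z)"
  by (induction n) (simp_all add: representsD[OF assms])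

lemma bounded_K_op_iff: "bounded_K_op T \<longleftrightarrow> (\<exists>A. represents A T \<and> bounded_clinear A)"
proof
  assume T: "bounded_K_op T"
  define A where "A z = inv l2sum_of (T (l2sum_of z))" for z
  have "T (l2sum_of z) \<in> range l2sum_of" for z
    using T unfolding bounded_K_op_def K2_eq_range_l2sum_of by blast
  then have T_A: "T (l2sum_of z) = l2sum_of (A z)" for z
    by (simp add: A_def f_inv_into_f)
  obtain M where M: "\<And>z. norm (A z) \<le> M * norm z"
    using T unfolding bounded_K_op_def K2_eq_range_l2sum_of by (auto simp: T_A Knorm_l2sum_of)
  have "bounded_clinear A"
  proof (rule bounded_clinear_intro[OF _ _ M])
    show "A (z + w) = A z + A w" for z w
    proof -
      have "T (Kadd (l2sum_of z) (l2sum_of w)) = Kadd (T (l2sum_of z)) (T (l2sum_of w))"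
        using T l2sum_of_in_K2 unfolding bounded_K_op_def by blast
      then show ?thesis by (simp add: T_A Kadd_l2sum_of inj_eq[OF inj_l2sum_of])
    qed
    show "A (c *\<^sub>C z) = c *\<^sub>C A z" for c z
    proof -
      have "T (Kscale c (l2sum_of z)) = Kscale c (T (l2sum_of z))"
        using T l2sum_of_in_K2 unfolding bounded_K_op_def by blast
      then show ?thesis by (simp add: T_A Kscale_l2sum_of inj_eq[OF inj_l2sum_of])
    qed
  qed
  then show "\<exists>A. represents A T \<and> bounded_clinear A" using T_A unfolding represents_def by blast
next
  assume "\<exists>A. represents A T \<and> bounded_clinear A"
  then obtain A where T: "represents A T" and "bounded_clinear A" by blast
  then interpret bounded_clinear A by simp
  obtain M where "\<And>z. norm (A z) \<le> norm z * M" using bounded by blast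
  then have "\<exists>M. \<forall>z. norm (A z) \<le> M * norm z" by (metis mult.commute)
  then show "bounded_K_op T"
    unfolding bounded_K_op_def K2_eq_range_l2sum_of
    by (auto simp: representsD[OF T] Kadd_l2sum_of Kscale_l2sum_of Knorm_l2sum_of add scaleC)
qed

lemma invertible_K_opE:
  assumes "invertible_K_op T"
  obtains A A' where "represents A T" "represents A' (inv_into K2 T)" "bounded_clinear A" "bounded_clinear A'"
    "\<And>z. A (A' z) = z" "\<And>z. A' (A z) = z"
proof -
  obtain A A' where A: "represents A T" "bounded_clinear A"
    and A': "represents A' (inv_into K2 T)" "bounded_clinear A'" and bij: "bij_betw T K2 K2"
    using assms unfolding invertible_K_op_def bounded_K_op_iff by blast
  have "l2sum_of (A (A' z)) = l2sum_of z" "l2sum_of (A' (A z)) = l2sum_of z" for z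
    using bij_betw_inv_into_right[OF bij, of "l2sum_of z"] bij_betw_inv_into_left[OF bij, of "l2sum_of z"]
    by (simp_all add: representsD[OF A(1)] representsD[OF A'(1)])
  then have "A (A' z) = z" "A' (A z) = z" for z by (simp_all only: inj_eq[OF inj_l2sum_of])
  then show ?thesis using A A' that by blast
qed

lemma invertible_K_op_exists:
  fixes A A' :: "'a::complex_inner ell2_pair \<Rightarrow> 'a ell2_pair"
  assumes clinear: "bounded_clinear A" "bounded_clinear A'"
    and inv: "\<And>z. A (A' z) = z" "\<And>z. A' (A z) = z"
  obtains T where "invertible_K_op T" "represents A T" "represents A' (inv_into K2 T)"
proof -
  define T where "T z = l2sum_of (A (inv l2sum_of z))" for z
  have T: "represents A T" by (simp add: represents_def T_def inv_f_f[OF inj_l2sum_of])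
  have "bij_betw T (range l2sum_of) (range l2sum_of)"
    by (rule bij_betw_byWitness[where f' = "\<lambda>z. l2sum_of (A' (inv l2sum_of z))"])
      (auto simp: representsD[OF T] inv_f_f[OF inj_l2sum_of] inv)
  then have bij: "bij_betw T K2 K2" by (simp only: K2_eq_range_l2sum_of)
  then have "inv_into K2 T (l2sum_of z) = l2sum_of (A' z)" for z
    by (intro inv_into_f_eq[OF bij_betw_imp_inj_on]) (simp_all only: representsD[OF T] inv l2sum_of_in_K2)
  then have T': "represents A' (inv_into K2 T)" unfolding represents_def by blast
  have "invertible_K_op T"
    unfolding invertible_K_op_def bounded_K_op_iff using bij T T' clinear by blast
  then show ?thesis using T T' by (rule that)
qed

theorem similar_to_contraction_iff:
  fixes A :: "'a::complex_inner ell2_pair \<Rightarrow> 'a ell2_pair"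
  assumes R: "represents A R"
  shows "similar_to_contraction R \<longleftrightarrow> similar_contraction A"
proof
  assume "similar_to_contraction R"
  then obtain T where T: "invertible_K_op T"
    and contraction: "\<And>z. z \<in> K2 \<Longrightarrow> Knorm (inv_into K2 T (R (T z))) \<le> Knorm z"
    unfolding similar_to_contraction_def by blast
  obtain B B' where B: "represents B T" "represents B' (inv_into K2 T)"
    and clinear: "bounded_clinear B" "bounded_clinear B'"
    and inv: "\<And>z. B (B' z) = z" "\<And>z. B' (B z) = z"
    using invertible_K_opE[OF T] by blast
  have "norm (B' (A (B z))) \<le> norm z" for z
    using contraction[of "l2sum_of z"]
    by (simp add: representsD[OF R] representsD[OF B(1)] representsD[OF B(2)] Knorm_l2sum_of)
  then show "similar_contraction A"
    unfolding similar_contraction_def using clinear inv by blast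
next
  assume "similar_contraction A"
  then obtain B B' :: "'a ell2_pair \<Rightarrow> 'a ell2_pair"
    where B: "bounded_clinear B" "bounded_clinear B'" "\<And>z. B (B' z) = z" "\<And>z. B' (B z) = z"
      and contraction: "\<And>z. norm (B' (A (B z))) \<le> norm z"
    unfolding similar_contraction_def by blast
  obtain T where "invertible_K_op T" and T: "represents B T" "represents B' (inv_into K2 T)"
    using invertible_K_op_exists[OF B] by blast
  moreover have "Knorm (inv_into K2 T (R (T z))) \<le> Knorm z" if "z \<in> K2" for z
  proof -
    from that obtain w where "z = l2sum_of w" unfolding K2_eq_range_l2sum_of by blast
    then show ?thesis
      by (simp add: representsD[OF R] representsD[OF T(1)] representsD[OF T(2)] Knorm_l2sum_of contraction)
  qed
  ultimately show "similar_to_contraction R"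
    unfolding similar_to_contraction_def by (intro exI[of _ T]) simp
qed

lemma Knorm_sum_funpow_differences:
  assumes R: "represents A R" and R': "represents A' R'" and x: "\<And>n. n \<in> I \<Longrightarrow> x n = l2sum_of (y n)"
  shows "Knorm (Ksum (\<lambda>n. Kdiff ((R ^^ n) (x n)) ((R' ^^ n) (x n))) I) =
    norm (\<Sum>n\<in>I. (A ^^ n) (y n) - (A' ^^ n) (y n))"
proof -
  have "Kdiff ((R ^^ n) (x n)) ((R' ^^ n) (x n)) = l2sum_of ((A ^^ n) (y n) - (A' ^^ n) (y n))" if "n \<in> I" for n
    by (simp only: x[OF that] represents_funpow[OF R] represents_funpow[OF R'] Kdiff_l2sum_of)
  then have "Ksum (\<lambda>n. Kdiff ((R ^^ n) (x n)) ((R' ^^ n) (x n))) I =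
      Ksum (\<lambda>n. l2sum_of ((A ^^ n) (y n) - (A' ^^ n) (y n))) I"
    by (simp add: Ksum_def)
  then show ?thesis by (simp only: Ksum_l2sum_of Knorm_l2sum_of)
qed

lemma quad_near_mod_H_iff:
  fixes R R' :: "'a::complex_inner l2sum \<Rightarrow> 'a l2sum"
  assumes R: "represents A R" and R': "represents A' R'"
  shows "quad_near_mod_H R R' \<longleftrightarrow> (\<exists>s. \<forall>N h.
    norm (\<Sum>n\<le>N. (A ^^ n) (0, single 0 (h n)) - (A' ^^ n) (0, single 0 (h n))) \<le> s * sqrt (\<Sum>n\<le>N. (norm (h n))\<^sup>2))"
  unfolding quad_near_mod_H_def
proof (intro ex_cong1 all_cong1 iffI allI impI)
  fix s N and h :: "nat \<Rightarrow> 'a"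
  let ?x = "\<lambda>n. l2sum_of (0, single 0 (h n))"
  assume near: "\<forall>x. (\<forall>n\<le>N. x n \<in> Hsub) \<longrightarrow>
    Knorm (Ksum (\<lambda>n. Kdiff ((R ^^ n) (x n)) ((R' ^^ n) (x n))) {..N}) \<le> s * sqrt (\<Sum>n\<le>N. (Knorm (x n))\<^sup>2)"
  have "Knorm (Ksum (\<lambda>n. Kdiff ((R ^^ n) (?x n)) ((R' ^^ n) (?x n))) {..N}) \<le> s * sqrt (\<Sum>n\<le>N. (Knorm (?x n))\<^sup>2)"
    using near[rule_format, of ?x] by (simp add: Hsub_eq_range)
  then show "norm (\<Sum>n\<le>N. (A ^^ n) (0, single 0 (h n)) - (A' ^^ n) (0, single 0 (h n))) \<le>
      s * sqrt (\<Sum>n\<le>N. (norm (h n))\<^sup>2)"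
    unfolding Knorm_sum_funpow_differences[OF R R' refl] by (simp add: Knorm_l2sum_of norm_Pair norm_single)
next
  fix s N and x :: "nat \<Rightarrow> 'a l2sum"
  assume near: "\<forall>h. norm (\<Sum>n\<le>N. (A ^^ n) (0, single 0 (h n)) - (A' ^^ n) (0, single 0 (h n))) \<le>
      s * sqrt (\<Sum>n\<le>N. (norm (h n))\<^sup>2)"
  assume "\<forall>n\<le>N. x n \<in> Hsub"
  then have "\<forall>n. \<exists>h. n \<le> N \<longrightarrow> x n = l2sum_of (0, single 0 h)" by (auto simp: Hsub_eq_range)
  then obtain h where x: "\<And>n. n \<in> {..N} \<Longrightarrow> x n = l2sum_of (0, single 0 (h n))" by (metis atMost_iff)
  have "Knorm (Ksum (\<lambda>n. Kdiff ((R ^^ n) (x n)) ((R' ^^ n) (x n))) {..N}) =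
      norm (\<Sum>n\<le>N. (A ^^ n) (0, single 0 (h n)) - (A' ^^ n) (0, single 0 (h n)))"
    by (rule Knorm_sum_funpow_differences[OF R R']) (rule x)
  moreover have "(\<Sum>n\<le>N. (Knorm (x n))\<^sup>2) = (\<Sum>n\<le>N. (norm (h n))\<^sup>2)"
    by (simp add: x Knorm_l2sum_of norm_Pair norm_single)
  ultimately show "Knorm (Ksum (\<lambda>n. Kdiff ((R ^^ n) (x n)) ((R' ^^ n) (x n))) {..N}) \<le>
      s * sqrt (\<Sum>n\<le>N. (Knorm (x n))\<^sup>2)"
    using near by simp
qed

lemma represents_R0: "represents (foguel (\<lambda>_. 0)) R0"
  by (simp add: represents_def R0_def l2sum_of_def foguel_def forward_shift.rep_eq backward_shift.rep_eq)

lemma represents_Rop: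
  assumes "\<And>x. coord (\<Gamma> x) = G (coord x)"
  shows "represents (foguel \<Gamma>) (Rop G)"
  by (simp add: represents_def Rop_def l2sum_of_def foguel_def forward_shift.rep_eq backward_shift.rep_eq
      fun_eq_iff flip: assms)

section \<open>Quadratic nearness of Foguel--Hankel operators\<close>

lemma sqrt_bound_iff_square_bound:
  fixes f g :: "'b \<Rightarrow> real"
  assumes "\<And>i. 0 \<le> f i" "\<And>i. 0 \<le> g i"
  shows "(\<exists>s. \<forall>i. f i \<le> s * sqrt (g i)) \<longleftrightarrow> (\<exists>B\<ge>0. \<forall>i. (f i)\<^sup>2 \<le> B * g i)"
proof
  assume "\<exists>s. \<forall>i. f i \<le> s * sqrt (g i)"
  then obtain s where s: "f i \<le> s * sqrt (g i)" for i by blast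
  have "(f i)\<^sup>2 \<le> s\<^sup>2 * g i" for i
    using power_mono[OF s[of i] assms(1), of 2] assms(2) by (simp add: power_mult_distrib)
  then show "\<exists>B\<ge>0. \<forall>i. (f i)\<^sup>2 \<le> B * g i" by (intro exI[of _ "s\<^sup>2"]) simp
next
  assume "\<exists>B\<ge>0. \<forall>i. (f i)\<^sup>2 \<le> B * g i"
  then obtain B where B: "(f i)\<^sup>2 \<le> B * g i" for i by blast
  have "f i \<le> sqrt B * sqrt (g i)" for i
    using real_le_rsqrt[OF B[of i]] by (simp add: real_sqrt_mult)
  then show "\<exists>s. \<forall>i. f i \<le> s * sqrt (g i)" by (intro exI[of _ "sqrt B"]) simp
qed

context car_hankel
begin

lemma represents_foguel_hankel: "represents (foguel hankel) (Rop (Hankel_op \<alpha> C))"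
  by (rule represents_Rop) (rule coord_hankel)

definition derived_sum :: "nat \<Rightarrow> (nat \<Rightarrow> 'a) \<Rightarrow> (nat, 'a) ell2" where
  "derived_sum N x = (\<Sum>j<N. fst ((foguel hankel ^^ Suc j) (0, single 0 (x j))))"

lemma coord_derived_sum: "coord (derived_sum N x) i = (\<Sum>j<N. derived_hankel i j (x j))"
  by (simp only: derived_sum_def coord_sum coord_fst_foguel_funpow)

lemma sum_foguel_hankel_differences:
  "(\<Sum>n\<le>N. (foguel hankel ^^ n) (0, single 0 (h n)) - (foguel (\<lambda>_. 0) ^^ n) (0, single 0 (h n))) =
    (derived_sum N (\<lambda>j. h (Suc j)), 0)"
proof -
  interpret S': bounded_clinear backward_shift by (rule bounded_clinear_backward_shift)
  have snd_funpow: "snd ((foguel \<Gamma> ^^ n) z) = (forward_shift ^^ n) (snd z)" for \<Gamma> n and z :: "'a ell2_pair"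
    by (induction n) (simp_all add: foguel_def)
  have "fst ((foguel (\<lambda>_. 0) ^^ n) (0, y)) = 0" for n and y :: "(nat, 'a) ell2"
    by (induction n) (simp_all add: foguel_def S'.zero)
  then have difference: "(foguel hankel ^^ n) (0, y) - (foguel (\<lambda>_. 0) ^^ n) (0, y) =
      (fst ((foguel hankel ^^ n) (0, y)), 0)" for n y
    by (simp add: snd_funpow prod_eq_iff)
  then show ?thesis
    unfolding difference
    by (simp add: prod_eq_iff fst_sum snd_sum sum.atMost_shift derived_sum_def del: funpow.simps)
qed

theorem quad_near_foguel_hankel_iff:
  "quad_near_mod_H (Rop (Hankel_op \<alpha> C)) R0 \<longleftrightarrow> (\<exists>B\<ge>0. matrix_bounded derived_hankel B)"
proof -
  have "quad_near_mod_H (Rop (Hankel_op \<alpha> C)) R0 \<longleftrightarrow>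
      (\<exists>s. \<forall>N h. norm (derived_sum N (\<lambda>j. h (Suc j))) \<le> s * sqrt (\<Sum>n\<le>N. (norm (h n))\<^sup>2))"
    unfolding quad_near_mod_H_iff[OF represents_foguel_hankel represents_R0]
    by (simp add: sum_foguel_hankel_differences norm_Pair)
  also have "\<dots> \<longleftrightarrow> (\<exists>B\<ge>0. \<forall>N h. (norm (derived_sum N (\<lambda>j. h (Suc j))))\<^sup>2 \<le> B * (\<Sum>n\<le>N. (norm (h n))\<^sup>2))"
    using sqrt_bound_iff_square_bound[of "\<lambda>(N, h). norm (derived_sum N (\<lambda>j. h (Suc j)))"
        "\<lambda>(N, h). \<Sum>n\<le>N. (norm (h n))\<^sup>2"]
    by (simp add: split_paired_all sum_nonneg case_prod_beta)
  also have "\<dots> \<longleftrightarrow> (\<exists>B\<ge>0. \<forall>N x. (norm (derived_sum N x))\<^sup>2 \<le> B * (\<Sum>j<N. (norm (x j))\<^sup>2))"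
  proof (intro ex_cong1 conj_cong refl iffI allI)
    fix B :: real and N and x :: "nat \<Rightarrow> 'a"
    assume "\<forall>N h. (norm (derived_sum N (\<lambda>j. h (Suc j))))\<^sup>2 \<le> B * (\<Sum>n\<le>N. (norm (h n))\<^sup>2)"
    from this[rule_format, of N "case_nat 0 x"]
    show "(norm (derived_sum N x))\<^sup>2 \<le> B * (\<Sum>j<N. (norm (x j))\<^sup>2)" by (simp add: sum.atMost_shift)
  next
    fix B :: real and N and h :: "nat \<Rightarrow> 'a"
    assume "0 \<le> B" and bound: "\<forall>N x. (norm (derived_sum N x))\<^sup>2 \<le> B * (\<Sum>j<N. (norm (x j))\<^sup>2)"
    have "(norm (derived_sum N (\<lambda>j. h (Suc j))))\<^sup>2 \<le> B * (\<Sum>j<N. (norm (h (Suc j)))\<^sup>2)"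
      using bound by blast
    also have "\<dots> \<le> B * (\<Sum>n\<le>N. (norm (h n))\<^sup>2)"
      using \<open>0 \<le> B\<close> by (intro mult_left_mono) (simp_all add: sum.atMost_shift)
    finally show "(norm (derived_sum N (\<lambda>j. h (Suc j))))\<^sup>2 \<le> B * (\<Sum>n\<le>N. (norm (h n))\<^sup>2)" .
  qed
  also have "\<dots> \<longleftrightarrow> (\<exists>B\<ge>0. matrix_bounded derived_hankel B)"
    unfolding matrix_bounded_def norm_ell2_square_le_iff coord_derived_sum by blast
  finally show ?thesis .
qed

end

lemma car_family_CAR:
  fixes e :: "nat \<Rightarrow> 'a::{complex_inner, complete_space}"
  assumes e: "orthonormal_basis e" and \<Lambda>: "CAR \<Lambda>"
  shows "car_family (\<lambda>n. \<Lambda> (e n)) (\<lambda>n. cadjoint (\<Lambda> (e n)))"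
proof
  show "cinner (\<Lambda> (e k) x) y = cinner x (cadjoint (\<Lambda> (e k)) y)" for k x y
    using \<Lambda> by (intro cinner_cadjoint) (simp add: CAR_def bounded_clinear_op_iff)
  show "\<Lambda> (e k) (cadjoint (\<Lambda> (e l)) x) + cadjoint (\<Lambda> (e l)) (\<Lambda> (e k) x) = (if k = l then x else 0)" for k l x
  proof -
    have "cinner (e k) (e l) = (if k = l then 1 else 0)" using e by (simp add: orthonormal_basis_def)
    then show ?thesis using \<Lambda> by (simp add: CAR_def)
  qed
  show "\<Lambda> (e k) (\<Lambda> (e l) x) + \<Lambda> (e l) (\<Lambda> (e k) x) = 0" for k l x
    using \<Lambda> by (simp add: CAR_def)
qed

theorem theorem6p1:
  fixes e :: "nat \<Rightarrow> 'a::{complex_inner, complete_space}"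
    and \<Lambda> :: "'a \<Rightarrow> 'a \<Rightarrow> 'a"
    and \<alpha> :: "nat \<Rightarrow> complex"
  assumes "orthonormal_basis e"
    and "CAR \<Lambda>"
    and "summable (\<lambda>n. (cmod (\<alpha> n))\<^sup>2)"
  shows "similar_to_contraction (Rop (Hankel_op \<alpha> (\<lambda>n. \<Lambda> (e n))))
     \<longleftrightarrow> quad_near_mod_H (Rop (Hankel_op \<alpha> (\<lambda>n. \<Lambda> (e n)))) R0"
proof -
  let ?C = "\<lambda>n. \<Lambda> (e n)"
  interpret car_hankel ?C "\<lambda>n. cadjoint (\<Lambda> (e n))" \<alpha>
    using car_family_CAR[OF assms(1,2)] assms(3) by (simp add: car_hankel_def car_hankel_axioms_def)
  have "cinner (e 0) (e 0) = 1" using assms(1) by (simp add: orthonormal_basis_def)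
  then have "e 0 \<noteq> 0" by auto
  have "similar_to_contraction (Rop (Hankel_op \<alpha> ?C)) \<longleftrightarrow> similar_contraction (foguel hankel)"
    by (rule similar_to_contraction_iff[OF represents_foguel_hankel])
  also have "\<dots> \<longleftrightarrow> (\<exists>B\<ge>0. matrix_bounded derived_hankel B)"
    by (rule similar_contraction_foguel_hankel_iff[OF \<open>e 0 \<noteq> 0\<close>])
  also have "\<dots> \<longleftrightarrow> quad_near_mod_H (Rop (Hankel_op \<alpha> ?C)) R0"
    by (rule quad_near_foguel_hankel_iff[symmetric])
  finally show ?thesis .
qed

end
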